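(* Let $X=\{x_i\}_{i=1}^{M}$ and $Y=\{y_i\}_{i=1}^{M}$ be ordered finite sets of (distinct) points in $\mathbb{CH}^n=\mathbb{B}^n$. The following are equivalent: (1) $X$ is congruent to $Y$: $X\sim Y$, i.e. there is $\Lambda\in\operatorname{Aut}(\mathbb{B}^n)$ with $\Lambda(x_i)=y_i$ for all $i$. (2) $X$ and $Y$ have the same normal form: $\Psi_X(X)=\Psi_Y(Y)$ as ordered sets. (3) The spaces $DA_n(X)$ and $DA_n(Y)$ are rescalings of each other: $DA_n(X)\sim DA_n(Y)$ (with $x_i$ corresponding to $y_i$). (4) The Gram matrices of the associated spaces are equivalent: $G(DA_n(X))\sim G(DA_n(Y))$. (5) The triangles of $X$ are congruent to the triangles of $Y$: for any triple of indices $i,j,k$ (not necessarily distinct) there is a $\Gamma_{ijk}\in\operatorname{Aut}(\mathbb{B}^n)$ with $\Gamma_{ijk}(x_i)=y_i$, $\Gamma_{ijk}(x_j)=y_j$, $\Gamma_{ijk}(x_k)=y_k$.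
   Context: $\mathbb{B}^n$ is the open unit ball of $\mathbb{C}^n$, with standard inner product $\langle\cdot,\cdot\rangle$; it is the model of complex hyperbolic space $\mathbb{CH}^n$. $\operatorname{Aut}(\mathbb{B}^n)$ is the group of biholomorphic self-maps of $\mathbb{B}^n$. $DA_n$ (Drury-Arveson space) is the Hilbert space of holomorphic functions on $\mathbb{B}^n$ with reproducing kernels $k_z(w)=(1-\langle w,z\rangle)^{-1}$. For finite $X\subset\mathbb{B}^n$, $DA_n(X)$ is the span of $\{k_x\}_{x\in X}$ in $DA_n$, with distinguished basis $\{k_x\}_{x\in X}$, regarded as a space of functions on $X$. Its Gram matrix is $G(DA_n(X))=(k_{ij})$, $k_{ij}=\langle k_{x_i},k_{x_j}\rangle=k_{x_i}(x_j)$. Rescaling: $DA_n(X)\sim DA_n(Y)$ means there is a nowhere vanishing $\gamma: X\to\mathbb{C}$ with $\langle k_{y_i},k_{y_j}\rangle=\gamma(x_i)\overline{\gamma(x_j)}\langle k_{x_i},k_{x_j}\rangle$ for all $i,j$. For $M\times M$ matrices, $A\sim B$ means there is a diagonal matrix $\Gamma$ with nonzero diagonal entries such that $\Gamma A\overline{\Gamma}=B$. Normal form: an ordered set $X=\{x_i\}_{i=1}^M\subset\mathbb{B}^n$ is in normal form (written $X\in\mathcal N$) if $x_1=0$ and in standard coordinates $x_j=(\alpha_{j1},\dots,\alpha_{jN(j)},0,\dots,0)$, where $N(1)=0$, $N$ is nondecreasing with differences $N(k+1)-N(k)\in\{0,1\}$, and $\alpha_{(k+1)N(k+1)}>0$ whenever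 $N(k+1)>N(k)$. For every finite ordered $X\subset\mathbb{B}^n$ there is $\Psi_X\in\operatorname{Aut}(\mathbb{B}^n)$ with $\Psi_X(X)\in\mathcal N$, and the ordered set $\Psi_X(X)$ is uniquely determined by $X$; it is called the normal form of $X$. *)

theory Defs
  imports "HOL-Analysis.Analysis" "Jordan_Normal_Form.Matrix"
begin

no_notation Matrix.vec_index (infixl "$" 100)

section \<open>The unit ball of complex Euclidean space and its automorphisms\<close>

definition herm :: "complex ^ 'n \<Rightarrow> complex ^ 'n \<Rightarrow> complex" where
  "herm z w = (\<Sum>i\<in>UNIV. z $ i * cnj (w $ i))"

abbreviation unit_ball :: "(complex ^ 'n) set" where
  "unit_ball \<equiv> ball 0 1"

definition holo_fun_on :: "(complex ^ 'n \<Rightarrow> complex) \<Rightarrow> (complex ^ 'n) set \<Rightarrow> bool" where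
  "holo_fun_on f S \<longleftrightarrow>
     (\<forall>z\<in>S. \<exists>D. (f has_derivative D) (at z) \<and> (\<forall>c v. D (c *s v) = c * D v))"

definition holo_map_on :: "(complex ^ 'n \<Rightarrow> complex ^ 'm) \<Rightarrow> (complex ^ 'n) set \<Rightarrow> bool" where
  "holo_map_on f S \<longleftrightarrow> (\<forall>i. holo_fun_on (\<lambda>z. f z $ i) S)"

text \<open>Automorphisms are total functions; their values off the ball are irrelevant.\<close>

definition ball_aut :: "(complex ^ 'n \<Rightarrow> complex ^ 'n) set" where
  "ball_aut = {f. bij_betw f unit_ball unit_ball \<and> holo_map_on f unit_ball \<and>
                  holo_map_on (inv_into unit_ball f) unit_ball}"

section \<open>Congruence and normal form of ordered point sets\<close>

definition congruent_sets :: "(complex ^ 'n) list \<Rightarrow> (complex ^ 'n) list \<Rightarrow> bool" where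
  "congruent_sets xs ys \<longleftrightarrow> (\<exists>f\<in>ball_aut. map f xs = ys)"

definition congruent_triangles :: "(complex ^ 'n) list \<Rightarrow> (complex ^ 'n) list \<Rightarrow> bool" where
  "congruent_triangles xs ys \<longleftrightarrow>
     (\<forall>i<length xs. \<forall>j<length xs. \<forall>k<length xs.
        \<exists>f\<in>ball_aut. f (xs ! i) = ys ! i \<and> f (xs ! j) = ys ! j \<and> f (xs ! k) = ys ! k)"

text \<open>
  The linear order of the index type enumerates the standard coordinates;
  \<open>coord_pos i\<close> is the position of \<open>i\<close>, counted from 1.
\<close>

definition coord_pos :: "'n::{finite,linorder} \<Rightarrow> nat" where
  "coord_pos i = card {..i}"

text \<open>Points are indexed from 0, so \<open>N k\<close> belongs to the point \<open>xs ! k\<close>.\<close>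

definition in_normal_form :: "(complex ^ 'n::{finite,linorder}) list \<Rightarrow> bool" where
  "in_normal_form xs \<longleftrightarrow>
     (\<forall>k<length xs. xs ! k \<in> unit_ball) \<and>
     (xs \<noteq> [] \<longrightarrow> xs ! 0 = 0) \<and>
     (\<exists>N :: nat \<Rightarrow> nat. N 0 = 0 \<and>
        (\<forall>k. Suc k < length xs \<longrightarrow> N (Suc k) = N k \<or> N (Suc k) = N k + 1) \<and>
        (\<forall>k<length xs. \<forall>i. N k < coord_pos i \<longrightarrow> xs ! k $ i = 0) \<and>
        (\<forall>k. Suc k < length xs \<and> N k < N (Suc k) \<longrightarrow>
           (\<exists>i. coord_pos i = N (Suc k) \<and> (\<exists>a::real. a > 0 \<and> xs ! Suc k $ i = of_real a))))"

definition normal_form ::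
    "(complex ^ 'n::{finite,linorder}) list \<Rightarrow> (complex ^ 'n::{finite,linorder}) list" where
  "normal_form xs = (THE ys. in_normal_form ys \<and> (\<exists>\<Psi>\<in>ball_aut. ys = map \<Psi> xs))"

section \<open>The Drury-Arveson space\<close>

text \<open>A Hilbert space whose vectors are functions with the pointwise vector space structure.\<close>

definition hilbert_fun_space ::
    "('a \<Rightarrow> complex) set \<Rightarrow> (('a \<Rightarrow> complex) \<Rightarrow> ('a \<Rightarrow> complex) \<Rightarrow> complex) \<Rightarrow> bool" where
  "hilbert_fun_space H ip \<longleftrightarrow>
     (\<lambda>_. 0) \<in> H \<and>
     (\<forall>f\<in>H. \<forall>g\<in>H. (\<lambda>x. f x + g x) \<in> H) \<and>
     (\<forall>c. \<forall>f\<in>H. (\<lambda>x. c * f x) \<in> H) \<and>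
     (\<forall>f\<in>H. \<forall>g\<in>H. \<forall>h\<in>H. ip (\<lambda>x. f x + g x) h = ip f h + ip g h) \<and>
     (\<forall>c. \<forall>f\<in>H. \<forall>g\<in>H. ip (\<lambda>x. c * f x) g = c * ip f g) \<and>
     (\<forall>f\<in>H. \<forall>g\<in>H. ip g f = cnj (ip f g)) \<and>
     (\<forall>f\<in>H. 0 \<le> Re (ip f f) \<and> (ip f f = 0 \<longrightarrow> f = (\<lambda>_. 0))) \<and>
     (\<forall>F. (\<forall>n. F n \<in> H) \<and>
          (\<forall>e>0. \<exists>n0. \<forall>m\<ge>n0. \<forall>n\<ge>n0.
             sqrt (Re (ip (\<lambda>x. F m x - F n x) (\<lambda>x. F m x - F n x))) < e) \<longrightarrow>
          (\<exists>f\<in>H. (\<lambda>n. sqrt (Re (ip (\<lambda>x. F n x - f x) (\<lambda>x. F n x - f x)))) \<longlonglongrightarrow> 0))"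

text \<open>Functions on the ball are represented by total functions that vanish off the ball.\<close>

definition da_kernel :: "complex ^ 'n \<Rightarrow> complex ^ 'n \<Rightarrow> complex" where
  "da_kernel z w = (if w \<in> unit_ball then 1 / (1 - herm w z) else 0)"

definition is_drury_arveson ::
    "(complex ^ 'n \<Rightarrow> complex) set \<Rightarrow>
     ((complex ^ 'n \<Rightarrow> complex) \<Rightarrow> (complex ^ 'n \<Rightarrow> complex) \<Rightarrow> complex) \<Rightarrow> bool" where
  "is_drury_arveson H ip \<longleftrightarrow>
     hilbert_fun_space H ip \<and>
     (\<forall>f\<in>H. holo_fun_on f unit_ball \<and> (\<forall>z. z \<notin> unit_ball \<longrightarrow> f z = 0)) \<and>
     (\<forall>z\<in>unit_ball. da_kernel z \<in> H \<and> (\<forall>f\<in>H. ip f (da_kernel z) = f z))"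

text \<open>
  A Hilbert space of functions is determined by its reproducing kernel, so the choice
  below only fixes irrelevant values of the inner product outside the space. Existence is
  theorem \<open>ex_drury_arveson\<close> at the end.
\<close>

definition drury_arveson ::
    "(complex ^ 'n \<Rightarrow> complex) set \<times>
     ((complex ^ 'n \<Rightarrow> complex) \<Rightarrow> (complex ^ 'n \<Rightarrow> complex) \<Rightarrow> complex)" where
  "drury_arveson = (SOME p. is_drury_arveson (fst p) (snd p))"

definition da_inner ::
    "(complex ^ 'n \<Rightarrow> complex) \<Rightarrow> (complex ^ 'n \<Rightarrow> complex) \<Rightarrow> complex" where
  "da_inner = snd drury_arveson"

section \<open>Rescaling and Gram matrices\<close>

definition da_rescaling :: "(complex ^ 'n) list \<Rightarrow> (complex ^ 'n) list \<Rightarrow> bool" where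
  "da_rescaling xs ys \<longleftrightarrow>
     (\<exists>\<gamma> :: complex ^ 'n \<Rightarrow> complex. (\<forall>x\<in>set xs. \<gamma> x \<noteq> 0) \<and>
        (\<forall>i<length xs. \<forall>j<length xs.
           da_inner (da_kernel (ys ! i)) (da_kernel (ys ! j)) =
           \<gamma> (xs ! i) * cnj (\<gamma> (xs ! j)) * da_inner (da_kernel (xs ! i)) (da_kernel (xs ! j))))"

definition da_gram :: "(complex ^ 'n) list \<Rightarrow> complex mat" where
  "da_gram xs = mat (length xs) (length xs)
     (\<lambda>(i, j). da_inner (da_kernel (xs ! i)) (da_kernel (xs ! j)))"

definition mat_equiv :: "complex mat \<Rightarrow> complex mat \<Rightarrow> bool" where
  "mat_equiv A B \<longleftrightarrow>
     (\<exists>\<Gamma>\<in>carrier_mat (dim_row A) (dim_row A). diagonal_mat \<Gamma> \<and>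
        (\<forall>i<dim_row A. \<Gamma> $$ (i, i) \<noteq> 0) \<and> \<Gamma> * A * map_mat cnj \<Gamma> = B)"

section \<open>Existence of the Drury-Arveson space\<close>

text \<open>
  Square-summable functions on words over the coordinates (the full Fock space), mapped to
  functions on the ball by pairing with \<open>cnj (mon z w)\<close>; the kernel of this map is
  divided out by passing to the double orthogonal complement of these vectors.
\<close>

definition l2 :: "('w \<Rightarrow> complex) set" where
  "l2 = {c. (\<lambda>w. (cmod (c w))\<^sup>2) summable_on UNIV}"

definition ip2 :: "('w \<Rightarrow> complex) \<Rightarrow> ('w \<Rightarrow> complex) \<Rightarrow> complex" where
  "ip2 a b = (\<Sum>\<^sub>\<infinity>w. a w * cnj (b w))"

definition nrm2 :: "('w \<Rightarrow> complex) \<Rightarrow> real" where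
  "nrm2 a = (\<Sum>\<^sub>\<infinity>w. (cmod (a w))\<^sup>2)"

lemma l2_zero: "(\<lambda>_. 0) \<in> l2"
  by (simp add: l2_def)

lemma l2_bounded:
  assumes "\<And>A. finite A \<Longrightarrow> (\<Sum>w\<in>A. (cmod (c w))\<^sup>2) \<le> C"
  shows "c \<in> l2" and "nrm2 c \<le> C"
proof -
  show *: "c \<in> l2"
    unfolding l2_def mem_Collect_eq
    by (rule nonneg_bdd_above_summable_on) (auto intro!: bdd_aboveI[of _ C] assms)
  show "nrm2 c \<le> C"
    using * unfolding l2_def nrm2_def by (intro infsum_le_finite_sums) (auto intro: assms)
qed

lemma l2_finite_le:
  assumes "c \<in> l2" "finite A"
  shows "(\<Sum>w\<in>A. (cmod (c w))\<^sup>2) \<le> nrm2 c"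
  using assms unfolding l2_def nrm2_def by (intro finite_sum_le_infsum) auto

lemma l2_L2_set_le:
  assumes "c \<in> l2" "finite A"
  shows "L2_set (\<lambda>w. cmod (c w)) A \<le> sqrt (nrm2 c)"
  unfolding L2_set_def using l2_finite_le[OF assms] by simp

lemma nrm2_nonneg: "0 \<le> nrm2 c"
  unfolding nrm2_def by (rule infsum_nonneg) simp

lemma l2_scale: "c \<in> l2 \<Longrightarrow> (\<lambda>w. k * c w) \<in> l2"
  unfolding l2_def by (simp add: norm_mult power_mult_distrib summable_on_cmult_right)

lemma l2_add:
  assumes "a \<in> l2" "b \<in> l2"
  shows "(\<lambda>w. a w + b w) \<in> l2"
proof (rule l2_bounded)
  fix A :: "'a set" assume A: "finite A"
  have "(cmod (a w + b w))\<^sup>2 \<le> 2 * (cmod (a w))\<^sup>2 + 2 * (cmod (b w))\<^sup>2" for w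
  proof -
    have "(cmod (a w + b w))\<^sup>2 \<le> (cmod (a w) + cmod (b w))\<^sup>2"
      by (intro power_mono norm_triangle_ineq) simp
    also have "\<dots> \<le> 2 * (cmod (a w))\<^sup>2 + 2 * (cmod (b w))\<^sup>2"
      using sum_squares_bound[of "cmod (a w)" "cmod (b w)"] by (simp add: power2_sum)
    finally show ?thesis .
  qed
  then have "(\<Sum>w\<in>A. (cmod (a w + b w))\<^sup>2) \<le> (\<Sum>w\<in>A. 2 * (cmod (a w))\<^sup>2 + 2 * (cmod (b w))\<^sup>2)"
    by (intro sum_mono)
  also have "\<dots> = 2 * (\<Sum>w\<in>A. (cmod (a w))\<^sup>2) + 2 * (\<Sum>w\<in>A. (cmod (b w))\<^sup>2)"
    by (simp add: sum.distrib sum_distrib_left)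
  also have "\<dots> \<le> 2 * nrm2 a + 2 * nrm2 b"
    using l2_finite_le[OF assms(1) A] l2_finite_le[OF assms(2) A] by simp
  finally show "(\<Sum>w\<in>A. (cmod (a w + b w))\<^sup>2) \<le> 2 * nrm2 a + 2 * nrm2 b" .
qed

lemma l2_diff:
  assumes "a \<in> l2" "b \<in> l2"
  shows "(\<lambda>w. a w - b w) \<in> l2"
  using l2_add[OF assms(1) l2_scale[OF assms(2), of "-1"]] by simp

lemma ip2_abs_summable:
  assumes "a \<in> l2" "b \<in> l2"
  shows "(\<lambda>w. norm (a w * cnj (b w))) summable_on UNIV"
proof (rule abs_summable_product[of a UNIV "\<lambda>w. cnj (b w)"])
  show "(\<lambda>w. norm (a w * a w)) summable_on UNIV"
    using assms(1) by (simp add: l2_def norm_mult power2_eq_square)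
  show "(\<lambda>w. norm (cnj (b w) * cnj (b w))) summable_on UNIV"
    using assms(2) by (simp add: l2_def norm_mult power2_eq_square)
qed

lemmas ip2_summable = abs_summable_summable[OF ip2_abs_summable]

lemma ip2_add: "a \<in> l2 \<Longrightarrow> b \<in> l2 \<Longrightarrow> c \<in> l2 \<Longrightarrow> ip2 (\<lambda>w. a w + b w) c = ip2 a c + ip2 b c"
  unfolding ip2_def by (simp add: distrib_right infsum_add ip2_summable)

lemma ip2_scale: "ip2 (\<lambda>w. k * a w) c = k * ip2 a c"
  unfolding ip2_def by (simp add: mult.assoc infsum_cmult_right')

lemma ip2_zero: "ip2 (\<lambda>_. 0) c = 0"
  unfolding ip2_def by simp

lemma ip2_diff: "a \<in> l2 \<Longrightarrow> b \<in> l2 \<Longrightarrow> c \<in> l2 \<Longrightarrow> ip2 (\<lambda>w. a w - b w) c = ip2 a c - ip2 b c"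
  using ip2_add[of a "\<lambda>w. -1 * b w" c] ip2_scale[of "-1" b c] l2_scale[of b "-1"] by simp

lemma ip2_cnj: "ip2 b a = cnj (ip2 a b)"
  unfolding ip2_def infsum_cnj[symmetric] by (simp add: mult.commute)

lemma ip2_self: "ip2 a a = of_real (nrm2 a)"
proof (cases "a \<in> l2")
  case True
  then have "((\<lambda>w. (cmod (a w))\<^sup>2) has_sum nrm2 a) UNIV"
    unfolding l2_def nrm2_def by simp
  then have "((\<lambda>w. complex_of_real ((cmod (a w))\<^sup>2)) has_sum of_real (nrm2 a)) UNIV"
    by (rule has_sum_of_real)
  then have "((\<lambda>w. a w * cnj (a w)) has_sum of_real (nrm2 a)) UNIV"
    unfolding complex_norm_square .
  then show ?thesis unfolding ip2_def by (rule infsumI)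
next
  case False
  have eq: "a w * cnj (a w) = of_real ((cmod (a w))\<^sup>2)" for w by (simp only: complex_norm_square)
  have "\<not> (\<lambda>w. a w * cnj (a w)) summable_on UNIV"
  proof
    assume "(\<lambda>w. a w * cnj (a w)) summable_on UNIV"
    then have "(\<lambda>w. Re (a w * cnj (a w))) summable_on UNIV" by (rule summable_on_Re)
    then show False using False unfolding eq l2_def by simp
  qed
  then show ?thesis using False unfolding ip2_def nrm2_def l2_def
    by (simp add: infsum_not_exists)
qed

lemma nrm2_eq_0:
  assumes "a \<in> l2" "nrm2 a = 0" shows "a = (\<lambda>_. 0)"
proof
  fix w
  have "(\<Sum>w\<in>{w}. (cmod (a w))\<^sup>2) \<le> nrm2 a" by (rule l2_finite_le) (use assms in auto)
  then show "a w = 0" using assms(2) by simp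
qed

lemma ip2_bound:
  assumes "a \<in> l2" "b \<in> l2"
  shows "cmod (ip2 a b) \<le> sqrt (nrm2 a) * sqrt (nrm2 b)"
proof -
  have "cmod (ip2 a b) \<le> (\<Sum>\<^sub>\<infinity>w. cmod (a w * cnj (b w)))"
    unfolding ip2_def by (rule norm_infsum_bound[OF ip2_abs_summable[OF assms]])
  also have "\<dots> \<le> sqrt (nrm2 a) * sqrt (nrm2 b)"
  proof (rule infsum_le_finite_sums[OF ip2_abs_summable[OF assms]])
    fix F :: "'a set" assume F: "finite F"
    have "(\<Sum>w\<in>F. cmod (a w * cnj (b w))) \<le> L2_set (\<lambda>w. cmod (a w)) F * L2_set (\<lambda>w. cmod (b w)) F"
      using L2_set_mult_ineq[of "\<lambda>w. cmod (a w)" "\<lambda>w. cmod (b w)" F] by (simp add: norm_mult)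
    also have "\<dots> \<le> sqrt (nrm2 a) * sqrt (nrm2 b)"
      by (intro mult_mono l2_L2_set_le assms F) (auto simp: nrm2_nonneg)
    finally show "(\<Sum>w\<in>F. cmod (a w * cnj (b w))) \<le> sqrt (nrm2 a) * sqrt (nrm2 b)" .
  qed
  finally show ?thesis .
qed

lemma ip2_tendsto:
  assumes "\<And>n. F n \<in> l2" "c \<in> l2" "d \<in> l2"
    and "(\<lambda>n. sqrt (nrm2 (\<lambda>w. F n w - c w))) \<longlonglongrightarrow> 0"
  shows "(\<lambda>n. ip2 (F n) d) \<longlonglongrightarrow> ip2 c d"
proof -
  have "(\<lambda>n. ip2 (F n) d - ip2 c d) \<longlonglongrightarrow> 0"
  proof (rule Lim_null_comparison)
    show "\<forall>\<^sub>F n in sequentially. norm (ip2 (F n) d - ip2 c d)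
        \<le> sqrt (nrm2 (\<lambda>w. F n w - c w)) * sqrt (nrm2 d)"
      using ip2_bound[OF l2_diff[OF assms(1,2)] assms(3)]
      unfolding ip2_diff[OF assms(1,2,3)] by simp
    show "(\<lambda>n. sqrt (nrm2 (\<lambda>w. F n w - c w)) * sqrt (nrm2 d)) \<longlonglongrightarrow> 0"
      using tendsto_mult_left_zero[OF assms(4)] .
  qed
  then show ?thesis by (simp add: LIM_zero_iff)
qed

lemma l2_complete:
  assumes F: "\<And>n. F n \<in> l2"
    and Cau: "\<And>e. e > 0 \<Longrightarrow> \<exists>n0. \<forall>m\<ge>n0. \<forall>n\<ge>n0. sqrt (nrm2 (\<lambda>w. F m w - F n w)) < e"
  shows "\<exists>c\<in>l2. (\<lambda>n. sqrt (nrm2 (\<lambda>w. F n w - c w))) \<longlonglongrightarrow> 0"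
proof -
  have pt: "cmod (F m w - F n w) \<le> sqrt (nrm2 (\<lambda>w. F m w - F n w))" for m n w
    using l2_L2_set_le[OF l2_diff[OF F F], of "{w}" m n] by simp
  have "Cauchy (\<lambda>n. F n w)" for w
    unfolding Cauchy_def dist_norm using Cau pt by (meson le_less_trans)
  then obtain c where c: "\<And>w. (\<lambda>n. F n w) \<longlonglongrightarrow> c w"
    unfolding Cauchy_convergent_iff convergent_def by metis
  have key: "\<exists>n0. \<forall>n\<ge>n0. (\<lambda>w. F n w - c w) \<in> l2 \<and> sqrt (nrm2 (\<lambda>w. F n w - c w)) \<le> e" if e: "e > 0" for e
  proof -
    obtain n0 where n0: "\<And>m n. m \<ge> n0 \<Longrightarrow> n \<ge> n0 \<Longrightarrow> sqrt (nrm2 (\<lambda>w. F m w - F n w)) < e"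
      using Cau[OF e] by blast
    have "(\<lambda>w. F n w - c w) \<in> l2 \<and> nrm2 (\<lambda>w. F n w - c w) \<le> e\<^sup>2" if n: "n \<ge> n0" for n
    proof -
      have "(\<Sum>w\<in>A. (cmod (F n w - c w))\<^sup>2) \<le> e\<^sup>2" if A: "finite A" for A
      proof (rule tendsto_upperbound)
        show "(\<lambda>m. \<Sum>w\<in>A. (cmod (F n w - F m w))\<^sup>2) \<longlonglongrightarrow> (\<Sum>w\<in>A. (cmod (F n w - c w))\<^sup>2)"
          by (intro tendsto_intros c)
        show "\<forall>\<^sub>F m in sequentially. (\<Sum>w\<in>A. (cmod (F n w - F m w))\<^sup>2) \<le> e\<^sup>2"
          unfolding eventually_sequentially
        proof (intro exI allI impI)
          fix m assume m: "m \<ge> n0"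
          have "(\<Sum>w\<in>A. (cmod (F n w - F m w))\<^sup>2) \<le> nrm2 (\<lambda>w. F n w - F m w)"
            by (rule l2_finite_le[OF l2_diff[OF F F] A])
          also have "\<dots> = (sqrt (nrm2 (\<lambda>w. F n w - F m w)))\<^sup>2" by (simp add: nrm2_nonneg)
          also have "\<dots> \<le> e\<^sup>2" using n0[OF n m] by (intro power_mono) (auto simp: nrm2_nonneg)
          finally show "(\<Sum>w\<in>A. (cmod (F n w - F m w))\<^sup>2) \<le> e\<^sup>2" .
        qed
      qed simp
      then show ?thesis using l2_bounded[of "\<lambda>w. F n w - c w" "e\<^sup>2"] by blast
    qed
    then have "(\<lambda>w. F n w - c w) \<in> l2 \<and> sqrt (nrm2 (\<lambda>w. F n w - c w)) \<le> e" if n: "n \<ge> n0" for n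
      using n e by (auto intro: real_le_lsqrt)
    then show ?thesis by blast
  qed
  obtain n where "(\<lambda>w. F n w - c w) \<in> l2" using key[of 1] by auto
  from l2_diff[OF F[of n] this] have "c \<in> l2" by simp
  moreover have "(\<lambda>n. sqrt (nrm2 (\<lambda>w. F n w - c w))) \<longlonglongrightarrow> 0"
  proof (rule LIMSEQ_I)
    fix r :: real assume "r > 0"
    then obtain n0 where n0: "\<And>n. n \<ge> n0 \<Longrightarrow> sqrt (nrm2 (\<lambda>w. F n w - c w)) \<le> r / 2"
      using key[of "r / 2"] by auto
    show "\<exists>n0. \<forall>n\<ge>n0. norm (sqrt (nrm2 (\<lambda>w. F n w - c w)) - 0) < r"
    proof (intro exI allI impI)
      fix n assume "n \<ge> n0"
      then have "sqrt (nrm2 (\<lambda>w. F n w - c w)) < r" using n0[of n] \<open>r > 0\<close> by linarith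
      then show "norm (sqrt (nrm2 (\<lambda>w. F n w - c w)) - 0) < r" by (simp add: nrm2_nonneg)
    qed
  qed
  ultimately show ?thesis by blast
qed

lemma ex_rkhs:
  fixes \<phi> :: "'a \<Rightarrow> 'w \<Rightarrow> complex"
  assumes phi: "\<And>x. x \<in> B \<Longrightarrow> \<phi> x \<in> l2"
  shows "\<exists>H ip. hilbert_fun_space H ip \<and>
     (\<forall>f\<in>H. \<exists>c\<in>l2. f = (\<lambda>x. if x \<in> B then ip2 c (\<phi> x) else 0)) \<and>
     (\<forall>x\<in>B. (\<lambda>y. if y \<in> B then ip2 (\<phi> x) (\<phi> y) else 0) \<in> H \<and>
        (\<forall>f\<in>H. ip f (\<lambda>y. if y \<in> B then ip2 (\<phi> x) (\<phi> y) else 0) = f x))"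
proof -
  define V where "V = {c\<in>l2. \<forall>d\<in>l2. (\<forall>x\<in>B. ip2 d (\<phi> x) = 0) \<longrightarrow> ip2 c d = 0}"
  define E where "E c = (\<lambda>x. if x \<in> B then ip2 c (\<phi> x) else 0)" for c
  define T where "T = inv_into V E"
  have V_l2: "c \<in> l2" if "c \<in> V" for c using that V_def by auto
  have V0: "(\<lambda>_. 0) \<in> V" by (simp add: V_def l2_zero ip2_zero)
  have V_add: "(\<lambda>w. c w + d w) \<in> V" if "c \<in> V" "d \<in> V" for c d
    using that by (auto simp: V_def l2_add ip2_add)
  have V_scale: "(\<lambda>w. k * c w) \<in> V" if "c \<in> V" for k c
    using that by (auto simp: V_def l2_scale ip2_scale)
  have V_diff: "(\<lambda>w. c w - d w) \<in> V" if "c \<in> V" "d \<in> V" for c d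
    using that by (auto simp: V_def l2_diff ip2_diff)
  have V_phi: "\<phi> x \<in> V" if "x \<in> B" for x
    using that phi ip2_cnj[of "\<phi> x"] by (auto simp: V_def)
  have E_add: "E (\<lambda>w. c w + d w) = (\<lambda>x. E c x + E d x)" if "c \<in> V" "d \<in> V" for c d
    using that V_l2 phi by (auto simp: E_def ip2_add)
  have E_diff: "E (\<lambda>w. c w - d w) = (\<lambda>x. E c x - E d x)" if "c \<in> V" "d \<in> V" for c d
    using that V_l2 phi by (auto simp: E_def ip2_diff)
  have E_scale: "E (\<lambda>w. k * c w) = (\<lambda>x. k * E c x)" for k c
    by (auto simp: E_def ip2_scale)
  have E0: "E (\<lambda>_. 0) = (\<lambda>_. 0)" by (auto simp: E_def ip2_zero)
  have "inj_on E V"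
  proof (rule inj_onI)
    fix c d assume cd: "c \<in> V" "d \<in> V" "E c = E d"
    let ?e = "\<lambda>w. c w - d w"
    have e: "?e \<in> V" using V_diff cd by blast
    have "E ?e = (\<lambda>_. 0)" using E_diff cd by simp
    then have "ip2 ?e (\<phi> x) = 0" if "x \<in> B" for x
      using that unfolding E_def by meson
    then have "ip2 ?e ?e = 0" using e unfolding V_def by blast
    then have "?e = (\<lambda>_. 0)" using nrm2_eq_0 V_l2[OF e] ip2_self[of ?e] by simp
    then show "c = d" by (metis eq_iff_diff_eq_0 ext)
  qed
  then have TE: "T (E c) = c" if "c \<in> V" for c
    using that unfolding T_def by (rule inv_into_f_f)
  define ip where "ip f g = ip2 (T f) (T g)" for f g
  have ipE: "ip (E c) (E d) = ip2 c d" if "c \<in> V" "d \<in> V" for c d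
    using that TE by (simp add: ip_def)
  have nE: "sqrt (Re (ip (\<lambda>x. E c x - E d x) (\<lambda>x. E c x - E d x))) = sqrt (nrm2 (\<lambda>w. c w - d w))"
    if "c \<in> V" "d \<in> V" for c d
    using ipE[OF V_diff[OF that] V_diff[OF that]] E_diff[OF that] by (simp add: ip2_self)
  have "hilbert_fun_space (E ` V) ip"
    unfolding hilbert_fun_space_def
  proof (intro conjI ballI allI impI)
    show "(\<lambda>_. 0) \<in> E ` V" using imageI[OF V0, of E] unfolding E0 .
  next
    fix f g assume "f \<in> E ` V" "g \<in> E ` V"
    then obtain a b where *: "a \<in> V" "b \<in> V" and f: "f = E a" "g = E b" by blast
    show "(\<lambda>x. f x + g x) \<in> E ` V"
      unfolding f E_add[OF *, symmetric] by (rule imageI[OF V_add[OF *]])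
  next
    fix k f assume "f \<in> E ` V"
    then obtain c where c: "c \<in> V" and f: "f = E c" by blast
    show "(\<lambda>x. k * f x) \<in> E ` V"
      unfolding f E_scale[symmetric] by (rule imageI[OF V_scale[OF c]])
  next
    fix f g h assume "f \<in> E ` V" "g \<in> E ` V" "h \<in> E ` V"
    then obtain a b c where *: "a \<in> V" "b \<in> V" "c \<in> V" and f: "f = E a" "g = E b" "h = E c" by blast
    show "ip (\<lambda>x. f x + g x) h = ip f h + ip g h"
      unfolding f E_add[OF *(1,2), symmetric] using * V_add V_l2 by (simp add: ipE ip2_add)
  next
    fix k f g assume "f \<in> E ` V" "g \<in> E ` V"
    then obtain a b where *: "a \<in> V" "b \<in> V" and f: "f = E a" "g = E b" by blast
    show "ip (\<lambda>x. k * f x) g = k * ip f g"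
      unfolding f E_scale[symmetric] using * V_scale by (simp add: ipE ip2_scale)
  next
    fix f g
    show "ip g f = cnj (ip f g)" unfolding ip_def by (rule ip2_cnj)
  next
    fix f
    show "0 \<le> Re (ip f f)" unfolding ip_def by (simp add: ip2_self nrm2_nonneg)
  next
    fix f assume "f \<in> E ` V" and z: "ip f f = 0"
    then obtain a where *: "a \<in> V" and f: "f = E a" by blast
    have "nrm2 a = 0" using z * by (simp add: f ipE ip2_self)
    then have "a = (\<lambda>_. 0)" by (rule nrm2_eq_0[OF V_l2[OF *]])
    then show "f = (\<lambda>_. 0)" using E0 f by simp
  next
    fix F :: "nat \<Rightarrow> 'a \<Rightarrow> complex"
    assume A: "(\<forall>n. F n \<in> E ` V) \<and>
          (\<forall>e>0. \<exists>n0. \<forall>m\<ge>n0. \<forall>n\<ge>n0.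
             sqrt (Re (ip (\<lambda>x. F m x - F n x) (\<lambda>x. F m x - F n x))) < e)"
    then obtain G where G: "\<And>n. G n \<in> V" and FG: "\<And>n. F n = E (G n)"
      unfolding image_iff by metis
    have "\<exists>c\<in>l2. (\<lambda>n. sqrt (nrm2 (\<lambda>w. G n w - c w))) \<longlonglongrightarrow> 0"
      using A unfolding FG nE[OF G G] by (intro l2_complete) (auto simp: V_l2 G)
    then obtain c where c: "c \<in> l2" and lim: "(\<lambda>n. sqrt (nrm2 (\<lambda>w. G n w - c w))) \<longlonglongrightarrow> 0" by blast
    have "c \<in> V"
      unfolding V_def
    proof (safe intro!: c)
      fix d :: "'w \<Rightarrow> complex" assume d: "d \<in> l2" "\<forall>x\<in>B. ip2 d (\<phi> x) = 0"
      have "(\<lambda>n. ip2 (G n) d) \<longlonglongrightarrow> ip2 c d"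
        by (rule ip2_tendsto[OF _ c d(1) lim]) (simp add: V_l2 G)
      moreover have "ip2 (G n) d = 0" for n using G[of n] d unfolding V_def by blast
      ultimately show "ip2 c d = 0" by (simp add: LIMSEQ_const_iff)
    qed
    then show "\<exists>f\<in>E ` V. (\<lambda>n. sqrt (Re (ip (\<lambda>x. F n x - f x) (\<lambda>x. F n x - f x)))) \<longlonglongrightarrow> 0"
      using lim G by (intro bexI[of _ "E c"]) (auto simp: FG nE)
  qed
  moreover have "\<forall>f\<in>E ` V. \<exists>c\<in>l2. f = (\<lambda>x. if x \<in> B then ip2 c (\<phi> x) else 0)"
    using V_l2 unfolding E_def by blast
  moreover have "E (\<phi> x) \<in> E ` V \<and> (\<forall>f\<in>E ` V. ip f (E (\<phi> x)) = f x)" if "x \<in> B" for x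
    using that V_phi by (auto simp: ipE) (simp add: E_def)
  ultimately show ?thesis unfolding E_def by (intro exI conjI) auto
qed


lemma finite_words: "finite {w :: 'n::finite list. length w = m}"
  using finite_lists_length_eq[of "UNIV :: 'n set" m] by simp

lemma sum_words_Suc:
  fixes g :: "'n::finite list \<Rightarrow> 'b::comm_monoid_add"
  shows "(\<Sum>w | length w = Suc m. g w) = (\<Sum>i\<in>UNIV. \<Sum>w | length w = m. g (i # w))"
proof -
  have eq: "{w :: 'n list. length w = Suc m} = (\<lambda>(i, w). i # w) ` (UNIV \<times> {w. length w = m})"
    by (auto simp: length_Suc_conv image_iff)
  have inj: "inj_on (\<lambda>(i :: 'n, w). i # w) (UNIV \<times> {w. length w = m})"
    by (auto simp: inj_on_def)
  show ?thesis
    unfolding eq sum.reindex[OF inj] sum.cartesian_product by (simp add: case_prod_unfold)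
qed

lemma sum_words_less:
  fixes g :: "'n::finite list \<Rightarrow> 'b::comm_monoid_add"
  shows "(\<Sum>w | length w < n. g w) = (\<Sum>m<n. \<Sum>w | length w = m. g w)"
proof -
  have eq: "{w :: 'n list. length w < n} = (\<Union>m\<in>{..<n}. {w. length w = m})" by auto
  show ?thesis unfolding eq
    by (rule sum.UNION_disjoint) (auto simp: finite_words)
qed

lemma finite_words_less: "finite {w :: 'n::finite list. length w < n}"
proof -
  have eq: "{w :: 'n list. length w < n} = (\<Union>m\<in>{..<n}. {w. length w = m})" by auto
  show ?thesis unfolding eq by (auto simp: finite_words)
qed

lemma finite_words_subset:
  assumes "finite F"
  shows "\<exists>n. F \<subseteq> {w :: 'n::finite list. length w < n}"
proof -
  have "w \<in> F \<Longrightarrow> length w < Suc (Max (length ` F))" for w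
    using assms by (simp add: less_Suc_eq_le)
  then show ?thesis by blast
qed

lemma has_sum_words_sums:
  fixes g :: "'n::finite list \<Rightarrow> 'b::real_normed_vector"
  assumes "(g has_sum s) UNIV"
  shows "(\<lambda>m. \<Sum>w | length w = m. g w) sums s"
proof -
  have "filterlim (\<lambda>n. {w :: 'n list. length w < n}) (finite_subsets_at_top UNIV) sequentially"
    unfolding filterlim_finite_subsets_at_top eventually_sequentially
  proof (intro allI impI)
    fix X :: "'n list set" assume "finite X \<and> X \<subseteq> UNIV"
    then obtain n0 where n0: "X \<subseteq> {w. length w < n0}" using finite_words_subset by blast
    have "X \<subseteq> {w. length w < n}" if "n \<ge> n0" for n using n0 that by force
    then show "\<exists>n0. \<forall>n\<ge>n0. finite {w :: 'n list. length w < n} \<and> X \<subseteq> {w. length w < n}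
        \<and> {w. length w < n} \<subseteq> UNIV"
      using finite_words_less by blast
  qed
  with assms have "(\<lambda>n. sum g {w. length w < n}) \<longlonglongrightarrow> s"
    unfolding has_sum_def by (rule filterlim_compose)
  then show ?thesis unfolding sums_def sum_words_less .
qed

lemma sum_words_prod_list:
  fixes b :: "'n::finite \<Rightarrow> 'b::comm_semiring_1"
  shows "(\<Sum>w | length w = m. prod_list (map b w)) = (\<Sum>i\<in>UNIV. b i) ^ m"
  by (induction m) (simp_all add: sum_words_Suc sum_distrib_left[symmetric] sum_distrib_right[symmetric])

lemma norm_prod_list_map: "cmod (prod_list (map b w)) = prod_list (map (\<lambda>i. cmod (b i)) w)"
  by (induction w) (simp_all add: norm_mult)

lemma words_summable:
  fixes b :: "'n::finite \<Rightarrow> real"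
  assumes nn: "\<And>i. b i \<ge> 0" and s: "(\<Sum>i\<in>UNIV. b i) < 1"
  shows "(\<lambda>w. prod_list (map b w)) summable_on UNIV"
proof (rule nonneg_bdd_above_summable_on)
  let ?s = "\<Sum>i\<in>UNIV. b i"
  have pos: "prod_list (map b w) \<ge> 0" for w
    by (induction w) (simp_all add: nn)
  show "prod_list (map b w) \<ge> 0" for w by (rule pos)
  have s0: "0 \<le> ?s" by (simp add: nn sum_nonneg)
  have "sum (\<lambda>w. prod_list (map b w)) F \<le> 1 / (1 - ?s)" if F: "finite F" for F
  proof -
    obtain n where "F \<subseteq> {w. length w < n}" using finite_words_subset[OF F] by blast
    then have "sum (\<lambda>w. prod_list (map b w)) F \<le> (\<Sum>w | length w < n. prod_list (map b w))"
      by (intro sum_mono2) (auto simp: finite_words_less pos)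
    also have "\<dots> = (\<Sum>m<n. ?s ^ m)" by (simp add: sum_words_less sum_words_prod_list)
    also have "\<dots> \<le> (\<Sum>m. ?s ^ m)" using s s0 by (intro sum_le_suminf summable_geometric) auto
    also have "\<dots> = 1 / (1 - ?s)" using s s0 by (intro suminf_geometric) auto
    finally show ?thesis .
  qed
  then show "bdd_above (sum (\<lambda>w. prod_list (map b w)) ` {F. F \<subseteq> UNIV \<and> finite F})"
    by (intro bdd_aboveI[of _ "1 / (1 - ?s)"]) auto
qed

lemma infsum_words:
  fixes b :: "'n::finite \<Rightarrow> complex"
  assumes s: "(\<Sum>i\<in>UNIV. cmod (b i)) < 1"
  shows "(\<Sum>\<^sub>\<infinity>w. prod_list (map b w)) = 1 / (1 - (\<Sum>i\<in>UNIV. b i))"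
proof -
  have "(\<lambda>w. norm (prod_list (map b w))) summable_on UNIV"
    unfolding norm_prod_list_map by (rule words_summable) (use s in auto)
  then have "(\<lambda>w. prod_list (map b w)) summable_on UNIV" by (rule abs_summable_summable)
  then have "(\<lambda>m. \<Sum>w | length w = m. prod_list (map b w)) sums (\<Sum>\<^sub>\<infinity>w. prod_list (map b w))"
    by (intro has_sum_words_sums has_sum_infsum)
  then have "(\<lambda>m. (\<Sum>i\<in>UNIV. b i) ^ m) sums (\<Sum>\<^sub>\<infinity>w. prod_list (map b w))"
    unfolding sum_words_prod_list .
  moreover have "(\<lambda>m. (\<Sum>i\<in>UNIV. b i) ^ m) sums (1 / (1 - (\<Sum>i\<in>UNIV. b i)))"
    by (rule geometric_sums) (use s norm_sum[of b UNIV] in linarith)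
  ultimately show ?thesis by (rule sums_unique2)
qed

definition mon :: "complex ^ 'n \<Rightarrow> 'n list \<Rightarrow> complex" where
  "mon z w = prod_list (map (\<lambda>i. z $ i) w)"

lemma norm_vec_L2: "norm (z :: complex ^ 'n) = L2_set (\<lambda>i. cmod (z $ i)) UNIV"
  by (simp add: norm_vec_def)

lemma cnj_prod_list_map: "cnj (prod_list (map b w)) = prod_list (map (\<lambda>i. cnj (b i)) w)"
  by (induction w) simp_all

lemma prod_list_map_mult:
  "prod_list (map a w) * prod_list (map b w) = prod_list (map (\<lambda>i. a i * b i :: 'b::comm_monoid_mult) w)"
  by (induction w) (simp_all add: ac_simps)

lemma mon_l2:
  assumes "z \<in> unit_ball" shows "(\<lambda>w. cnj (mon z w)) \<in> l2"
proof -
  have "(\<Sum>i\<in>UNIV. (cmod (z $ i))\<^sup>2) = (norm z)\<^sup>2"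
    unfolding norm_vec_L2 L2_set_def by (simp add: sum_nonneg)
  also have "\<dots> < 1" using assms by (simp add: power_less_one_iff abs_square_less_1)
  finally have "(\<lambda>w. prod_list (map (\<lambda>i. (cmod (z $ i))\<^sup>2) w)) summable_on UNIV"
    by (intro words_summable) auto
  moreover have "(cmod (cnj (mon z w)))\<^sup>2 = prod_list (map (\<lambda>i. (cmod (z $ i))\<^sup>2) w)" for w
    by (simp add: mon_def norm_prod_list_map power2_eq_square prod_list_map_mult)
  ultimately show ?thesis by (simp add: l2_def)
qed

lemma ip2_mon:
  assumes "z \<in> unit_ball" "w \<in> unit_ball"
  shows "ip2 (\<lambda>u. cnj (mon z u)) (\<lambda>u. cnj (mon w u)) = 1 / (1 - herm w z)"
proof -
  have "(\<Sum>i\<in>UNIV. cmod (w $ i * cnj (z $ i))) \<le> norm w * norm z"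
    using L2_set_mult_ineq[of "\<lambda>i. cmod (w $ i)" "\<lambda>i. cmod (z $ i)" UNIV]
    by (simp add: norm_mult norm_vec_L2)
  also have "\<dots> < 1"
  proof -
    have "norm w * norm z \<le> norm w * 1" using assms by (intro mult_left_mono) auto
    also have "\<dots> < 1" using assms by simp
    finally show ?thesis .
  qed
  finally have "(\<Sum>\<^sub>\<infinity>u. prod_list (map (\<lambda>i. w $ i * cnj (z $ i)) u)) = 1 / (1 - herm w z)"
    unfolding herm_def by (rule infsum_words)
  moreover have "cnj (mon z u) * cnj (cnj (mon w u)) = prod_list (map (\<lambda>i. w $ i * cnj (z $ i)) u)" for u
    by (simp add: mon_def cnj_prod_list_map prod_list_map_mult mult.commute)
  ultimately show ?thesis by (simp add: ip2_def)
qed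

text \<open>
  \<open>hpoly m c\<close> is the sum of \<open>c w\<close> times the monomial \<open>w\<close> over the words \<open>w\<close> of
  length \<open>m\<close>, and \<open>dhpoly m c z\<close> is its derivative at \<open>z\<close>.
\<close>

primrec hpoly :: "nat \<Rightarrow> ('n list \<Rightarrow> complex) \<Rightarrow> complex ^ 'n \<Rightarrow> complex" where
  "hpoly 0 c z = c []"
| "hpoly (Suc m) c z = (\<Sum>i\<in>UNIV. z $ i * hpoly m (\<lambda>w. c (i # w)) z)"

primrec dhpoly ::
    "nat \<Rightarrow> ('n list \<Rightarrow> complex) \<Rightarrow> complex ^ 'n \<Rightarrow> complex ^ 'n \<Rightarrow> complex" where
  "dhpoly 0 c z h = 0"
| "dhpoly (Suc m) c z h =
     (\<Sum>i\<in>UNIV. z $ i * dhpoly m (\<lambda>w. c (i # w)) z h + h $ i * hpoly m (\<lambda>w. c (i # w)) z)"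

definition cnorm :: "nat \<Rightarrow> ('n::finite list \<Rightarrow> complex) \<Rightarrow> real" where
  "cnorm m c = L2_set (\<lambda>w. cmod (c w)) {w. length w = m}"

lemma cnorm_nonneg: "0 \<le> cnorm m c"
  by (simp add: cnorm_def)

lemma cnorm_Suc: "cnorm (Suc m) c = L2_set (\<lambda>i. cnorm m (\<lambda>w. c (i # w))) UNIV"
  by (simp add: cnorm_def L2_set_def sum_words_Suc sum_nonneg)

lemma cnorm_sum_le:
  fixes z :: "complex ^ 'n"
  shows "(\<Sum>i\<in>UNIV. cmod (z $ i) * cnorm m (\<lambda>w. c (i # w))) \<le> norm z * cnorm (Suc m) c"
  using L2_set_mult_ineq[of "\<lambda>i. cmod (z $ i)" "\<lambda>i. cnorm m (\<lambda>w. c (i # w))" UNIV]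
  by (simp add: cnorm_Suc cnorm_nonneg norm_vec_L2)

lemma hpoly_eq: "hpoly m c z = (\<Sum>w | length w = m. c w * mon z w)"
  by (induction m arbitrary: c)
     (simp_all add: sum_words_Suc mon_def sum_distrib_left mult.left_commute)

lemma hpoly_bound: "cmod (hpoly m c z) \<le> cnorm m c * norm z ^ m"
proof (induction m arbitrary: c)
  case 0
  show ?case by (simp add: cnorm_def)
next
  case (Suc m)
  have "cmod (hpoly (Suc m) c z) \<le> (\<Sum>i\<in>UNIV. cmod (z $ i * hpoly m (\<lambda>w. c (i # w)) z))"
    by (simp add: norm_sum)
  also have "\<dots> \<le> (\<Sum>i\<in>UNIV. cmod (z $ i) * cnorm m (\<lambda>w. c (i # w)) * norm z ^ m)"
    using Suc by (intro sum_mono) (simp add: norm_mult mult.assoc mult_left_mono)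
  also have "\<dots> = (\<Sum>i\<in>UNIV. cmod (z $ i) * cnorm m (\<lambda>w. c (i # w))) * norm z ^ m"
    by (simp add: sum_distrib_right)
  also have "\<dots> \<le> norm z * cnorm (Suc m) c * norm z ^ m"
    by (intro mult_right_mono cnorm_sum_le) simp
  finally show ?case by (simp add: ac_simps)
qed

lemma dhpoly_bound:
  "cmod (dhpoly m c z h) \<le> real m * cnorm m c * norm z ^ (m - 1) * norm h"
proof (induction m arbitrary: c)
  case 0
  show ?case by simp
next
  case (Suc m)
  let ?c = "\<lambda>i w. c (i # w)"
  have pw: "real m * norm z ^ (m - 1) * norm z = real m * norm z ^ m"
    by (cases m) auto
  have "cmod (dhpoly (Suc m) c z h)
      \<le> (\<Sum>i\<in>UNIV. cmod (z $ i * dhpoly m (?c i) z h + h $ i * hpoly m (?c i) z))"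
    by (simp add: norm_sum)
  also have "\<dots> \<le> (\<Sum>i\<in>UNIV. cmod (z $ i) * cnorm m (?c i) * (real m * norm z ^ (m - 1) * norm h)
                          + cmod (h $ i) * cnorm m (?c i) * norm z ^ m)"
  proof (rule sum_mono)
    fix i
    have "cmod (z $ i * dhpoly m (?c i) z h + h $ i * hpoly m (?c i) z)
        \<le> cmod (z $ i) * cmod (dhpoly m (?c i) z h) + cmod (h $ i) * cmod (hpoly m (?c i) z)"
      by (metis norm_mult norm_triangle_ineq)
    also have "\<dots> \<le> cmod (z $ i) * (real m * cnorm m (?c i) * norm z ^ (m - 1) * norm h)
        + cmod (h $ i) * (cnorm m (?c i) * norm z ^ m)"
      by (intro add_mono mult_left_mono Suc hpoly_bound) auto
    finally show "cmod (z $ i * dhpoly m (?c i) z h + h $ i * hpoly m (?c i) z)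
        \<le> cmod (z $ i) * cnorm m (?c i) * (real m * norm z ^ (m - 1) * norm h)
           + cmod (h $ i) * cnorm m (?c i) * norm z ^ m"
      by (simp add: ac_simps)
  qed
  also have "\<dots> = (\<Sum>i\<in>UNIV. cmod (z $ i) * cnorm m (?c i)) * (real m * norm z ^ (m - 1) * norm h)
        + (\<Sum>i\<in>UNIV. cmod (h $ i) * cnorm m (?c i)) * norm z ^ m"
    by (simp add: sum_distrib_right sum.distrib)
  also have "\<dots> \<le> norm z * cnorm (Suc m) c * (real m * norm z ^ (m - 1) * norm h)
        + norm h * cnorm (Suc m) c * norm z ^ m"
    by (intro add_mono mult_right_mono cnorm_sum_le) auto
  also have "\<dots> = cnorm (Suc m) c * norm h * (real m * norm z ^ (m - 1) * norm z)
        + norm h * cnorm (Suc m) c * norm z ^ m"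
    by (simp add: ac_simps)
  also have "\<dots> = real (Suc m) * cnorm (Suc m) c * norm z ^ (Suc m - 1) * norm h"
    unfolding pw by (simp add: algebra_simps)
  finally show ?case .
qed

lemma dhpoly_scale: "dhpoly m c z (k *s h) = k * dhpoly m c z h"
  by (induction m arbitrary: c) (simp_all add: sum_distrib_left algebra_simps)

lemma hpoly_has_derivative: "(hpoly m c has_derivative dhpoly m c z) (at z within S)"
proof (induction m arbitrary: c)
  case 0
  have "hpoly 0 c = (\<lambda>_. c [])" "dhpoly 0 c z = (\<lambda>_. 0)" by auto
  then show ?case by simp
next
  case (Suc m)
  have 1: "hpoly (Suc m) c = (\<lambda>z. \<Sum>i\<in>UNIV. z $ i * hpoly m (\<lambda>w. c (i # w)) z)" by auto
  have 2: "dhpoly (Suc m) c z = (\<lambda>h. \<Sum>i\<in>UNIV. z $ i * dhpoly m (\<lambda>w. c (i # w)) z h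
      + h $ i * hpoly m (\<lambda>w. c (i # w)) z)" by auto
  have 3: "((\<lambda>z. z $ i) has_derivative (\<lambda>h. h $ i)) (at z within S)" for i
    by (rule bounded_linear_imp_has_derivative[OF bounded_linear_vec_nth])
  show ?case unfolding 1 2
    by (intro has_derivative_sum has_derivative_mult 3 Suc)
qed

lemma cnorm_le: "c \<in> l2 \<Longrightarrow> cnorm m c \<le> sqrt (nrm2 c)"
  unfolding cnorm_def by (rule l2_L2_set_le) (simp_all add: finite_words)

lemma ip2_mon_sums:
  assumes "c \<in> l2" "z \<in> unit_ball"
  shows "(\<lambda>m. hpoly m c z) sums ip2 c (\<lambda>w. cnj (mon z w))"
proof -
  have "((\<lambda>w. c w * cnj (cnj (mon z w))) has_sum ip2 c (\<lambda>w. cnj (mon z w))) UNIV"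
    unfolding ip2_def by (intro has_sum_infsum ip2_summable assms mon_l2)
  then show ?thesis using has_sum_words_sums unfolding hpoly_eq by fastforce
qed

lemma holo_ip2_mon:
  assumes c: "c \<in> l2" and z: "(z :: complex ^ 'n) \<in> unit_ball"
  shows "\<exists>D. ((\<lambda>z. ip2 c (\<lambda>w. cnj (mon z w))) has_derivative D) (at z) \<and>
             (\<forall>k v. D (k *s v) = k * D v)"
proof -
  define r where "r = (norm z + 1) / 2"
  define C where "C = sqrt (nrm2 c)"
  define a where "a m = real m * C * r ^ (m - 1)" for m
  have r: "norm z < r" "r < 1" "0 < r" using z by (auto simp: r_def) (smt (verit) norm_ge_zero)
  have C: "0 \<le> C" by (simp add: C_def nrm2_nonneg)
  have "(\<lambda>n. of_nat (Suc n) * r ^ n) sums (1 / (1 - r)\<^sup>2)"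
    by (rule geometric_deriv_sums) (use r in auto)
  then have "summable (\<lambda>n. C * (of_nat (Suc n) * r ^ n))"
    by (intro summable_mult) (rule sums_summable)
  then have "summable (\<lambda>n. a (Suc n))" by (simp add: a_def ac_simps)
  then have sa: "summable a" by (simp add: summable_Suc_iff)
  have a0: "0 \<le> a m" for m using C r by (simp add: a_def)
  have bd: "norm (dhpoly m c x h) \<le> a m * norm h" if "x \<in> ball 0 r" for m x h
  proof -
    have "norm (dhpoly m c x h) \<le> real m * cnorm m c * norm x ^ (m - 1) * norm h"
      by (rule dhpoly_bound)
    also have "\<dots> \<le> real m * C * r ^ (m - 1) * norm h"
      using that cnorm_le[OF c] r C cnorm_nonneg unfolding C_def
      by (intro mult_mono power_mono) (auto intro!: mult_nonneg_nonneg simp: nrm2_nonneg)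
    finally show ?thesis by (simp add: a_def)
  qed
  define D where "D x h = (\<Sum>m. dhpoly m c x h)" for x h
  have sD: "summable (\<lambda>m. dhpoly m c x h)" if "x \<in> ball 0 r" for x h
    by (rule summable_comparison_test'[OF summable_mult2[OF sa, of "norm h"], of 0])
       (use bd[OF that] in auto)
  have ex: "\<exists>g. \<forall>x\<in>ball 0 r. (\<lambda>n. hpoly n c x) sums g x \<and> (g has_derivative D x) (at x within ball 0 r)"
  proof (rule has_derivative_series)
    show "convex (ball (0 :: complex ^ 'n) r)" by simp
    show "(hpoly n c has_derivative dhpoly n c x) (at x within ball 0 r)" for n x
      by (rule hpoly_has_derivative)
    show "z \<in> ball 0 r" using r by simp
    show "(\<lambda>n. hpoly n c z) sums ip2 c (\<lambda>w. cnj (mon z w))" by (rule ip2_mon_sums[OF c z])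
    fix e :: real assume e: "e > 0"
    obtain n0 where n0: "\<And>n. n \<ge> n0 \<Longrightarrow> norm (\<Sum>i. a (i + n)) < e"
      using suminf_exist_split[OF e sa] by blast
    show "\<forall>\<^sub>F n in sequentially. \<forall>x\<in>ball 0 r. \<forall>h.
        norm ((\<Sum>i<n. dhpoly i c x h) - D x h) \<le> e * norm h"
      unfolding eventually_sequentially
    proof (intro exI allI impI ballI)
      fix n :: nat and x :: "complex ^ 'n" and h :: "complex ^ 'n"
      assume n: "n \<ge> n0" and x: "x \<in> ball 0 r"
      have sn: "summable (\<lambda>i. a (i + n) * norm h)"
        by (intro summable_mult2 summable_ignore_initial_segment sa)
      have "norm ((\<Sum>i<n. dhpoly i c x h) - D x h) = norm (\<Sum>i. dhpoly (i + n) c x h)"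
        unfolding D_def using suminf_minus_initial_segment[OF sD[OF x, of h], of n]
        by (simp add: norm_minus_commute)
      also have "\<dots> \<le> (\<Sum>i. a (i + n) * norm h)"
        by (rule norm_suminf_le[OF bd[OF x] sn])
      also have "\<dots> = (\<Sum>i. a (i + n)) * norm h"
        by (rule suminf_mult2[symmetric, OF summable_ignore_initial_segment[OF sa]])
      also have "\<dots> \<le> e * norm h"
        using n0[OF n] by (intro mult_right_mono) auto
      finally show "norm ((\<Sum>i<n. dhpoly i c x h) - D x h) \<le> e * norm h" .
    qed
  qed
  then obtain g where g: "\<And>x. x \<in> ball 0 r \<Longrightarrow> (\<lambda>n. hpoly n c x) sums g x"
    and dg: "\<And>x. x \<in> ball 0 r \<Longrightarrow> (g has_derivative D x) (at x within ball 0 r)" by blast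
  have zr: "z \<in> ball 0 r" using r by simp
  have "(g has_derivative D z) (at z)"
    using dg[OF zr] at_within_open[OF zr open_ball] by simp
  then have "((\<lambda>z. ip2 c (\<lambda>w. cnj (mon z w))) has_derivative D z) (at z)"
  proof (rule has_derivative_transform_within_open[OF _ open_ball zr])
    fix x :: "complex ^ 'n" assume x: "x \<in> ball 0 r"
    then have "x \<in> unit_ball" using r by simp
    from sums_unique2[OF g[OF x] ip2_mon_sums[OF c this]]
    show "g x = ip2 c (\<lambda>w. cnj (mon x w))" .
  qed
  moreover have "D z (k *s v) = k * D z v" for k v
    unfolding D_def dhpoly_scale by (rule suminf_mult[OF sD[OF zr]])
  ultimately show ?thesis by blast
qed

theorem ex_drury_arveson:
  "\<exists>H ip. is_drury_arveson (H :: (complex ^ 'n \<Rightarrow> complex) set) ip"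
proof -
  define \<phi> :: "complex ^ 'n \<Rightarrow> 'n list \<Rightarrow> complex" where "\<phi> z = (\<lambda>w. cnj (mon z w))" for z
  have phi: "\<phi> z \<in> l2" if "z \<in> unit_ball" for z
    using mon_l2[OF that] by (simp add: \<phi>_def)
  have K: "da_kernel z = (\<lambda>y. if y \<in> unit_ball then ip2 (\<phi> z) (\<phi> y) else 0)"
    if "z \<in> unit_ball" for z
    using that by (auto simp: da_kernel_def \<phi>_def ip2_mon)
  obtain H ip where H: "hilbert_fun_space H ip"
    and rep: "\<And>f. f \<in> H \<Longrightarrow> \<exists>c\<in>l2. f = (\<lambda>x. if x \<in> unit_ball then ip2 c (\<phi> x) else 0)"
    and ker: "\<And>x. x \<in> unit_ball \<Longrightarrow> da_kernel x \<in> H \<and> (\<forall>f\<in>H. ip f (da_kernel x) = f x)"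
    using ex_rkhs[of unit_ball \<phi>, OF phi] K by (auto; metis)
  have "holo_fun_on f unit_ball \<and> (\<forall>z. z \<notin> unit_ball \<longrightarrow> f z = 0)" if f: "f \<in> H" for f
  proof -
    obtain c where c: "c \<in> l2" and fc: "f = (\<lambda>x. if x \<in> unit_ball then ip2 c (\<phi> x) else 0)"
      using rep[OF f] by blast
    have "holo_fun_on f unit_ball"
      unfolding holo_fun_on_def
    proof
      fix z :: "complex ^ 'n" assume z: "z \<in> unit_ball"
      from holo_ip2_mon[OF c z] obtain D where
        D: "((\<lambda>z. ip2 c (\<phi> z)) has_derivative D) (at z)" "\<forall>k v. D (k *s v) = k * D v"
        unfolding \<phi>_def by blast
      have "(f has_derivative D) (at z)"
        by (rule has_derivative_transform_within_open[OF D(1) open_ball z]) (simp add: fc)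
      with D(2) show "\<exists>D. (f has_derivative D) (at z) \<and> (\<forall>c v. D (c *s v) = c * D v)" by blast
    qed
    then show ?thesis by (simp add: fc)
  qed
  then have "is_drury_arveson H ip"
    unfolding is_drury_arveson_def using H ker by blast
  then show ?thesis by blast
qed

lemma drury_arveson:
  "is_drury_arveson (fst drury_arveson :: (complex ^ 'n \<Rightarrow> complex) set) (snd drury_arveson)"
proof -
  have "\<exists>p. is_drury_arveson (fst p :: (complex ^ 'n \<Rightarrow> complex) set) (snd p)"
    using ex_drury_arveson by simp
  then show ?thesis unfolding drury_arveson_def by (rule someI_ex)
qed

lemma da_inner_kernel:
  assumes "x \<in> unit_ball" "y \<in> unit_ball"
  shows "da_inner (da_kernel x) (da_kernel y) = da_kernel x y"
  using drury_arveson assms unfolding is_drury_arveson_def da_inner_def by blast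

end

theory Submission
  imports Defs "HOL-Complex_Analysis.Conformal_Mappings"
begin

text \<open>
  By the Schwarz lemma on complex lines through \<open>0\<close>, an automorphism of the ball fixing \<open>0\<close> is
  unitary. Moving the first point to \<open>0\<close> by an involution therefore turns congruence into equality
  of the Hermitian products of the remaining points, and each such product involves only three of
  the original points: this gives the triangle criterion. The involution multiplies the kernel
  \<open>1 / (1 - herm w z)\<close> by a rank one factor, so the same products are also exactly the invariants of
  the kernel under rescaling. Finally, an ordered set in normal form can be recovered from its
  Hermitian products by the Gram-Schmidt procedure, and reflections bring every set with first
  point \<open>0\<close> into normal form.
\<close>

section \<open>The Hermitian form\<close>

text \<open>The conditions meet in one matrix, \<open>centered_gram\<close>: the Gram matrix of the
  list after the involution has sent its first point to the origin. The triangle condition may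
  provide a different automorphism for every triple, and these cannot be glued directly; but the
  entry at \<open>i\<close>, \<open>j\<close> needs only the triple \<open>0\<close>,
  \<open>i\<close>, \<open>j\<close>, and the whole matrix determines the list up to congruence. The
  centered points may be linearly dependent, so equal Gram matrices give an isometry only between
  spans. Instead of extending it, both lists are carried to normal form by explicit unitary maps;
  the witness \<open>N\<close> records at which points the span grows. For the kernel,
  \<open>1 - centered_gram\<close> is a cross ratio of the numbers \<open>1 - herm z w\<close>.
  Scalars attached to the points cancel in it, and normalising at the first point recovers
  them.\<close>

lemma herm_add_left: "herm (x + y) z = herm x z + herm y z"
  by (simp add: herm_def distrib_right sum.distrib)

lemma herm_add_right: "herm z (x + y) = herm z x + herm z y"
  by (simp add: herm_def distrib_left sum.distrib)

lemma herm_diff_left: "herm (x - y) z = herm x z - herm y z"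
  by (simp add: herm_def left_diff_distrib sum_subtractf)

lemma herm_diff_right: "herm z (x - y) = herm z x - herm z y"
  by (simp add: herm_def right_diff_distrib sum_subtractf)

lemma herm_scale_left: "herm (c *s x) z = c * herm x z"
  by (simp add: herm_def sum_distrib_left mult.assoc)

lemma herm_scale_right: "herm z (c *s x) = cnj c * herm z x"
  by (simp add: herm_def sum_distrib_left mult.left_commute)

lemma herm_zero_left: "herm 0 z = 0"
  by (simp add: herm_def)

lemma herm_zero_right: "herm z 0 = 0"
  by (simp add: herm_def)

lemmas herm_simps = herm_add_left herm_add_right herm_diff_left herm_diff_right
  herm_scale_left herm_scale_right herm_zero_left herm_zero_right

lemma cnj_herm: "cnj (herm z w) = herm w z"
  by (simp add: herm_def mult.commute)

lemma herm_self: "herm z z = of_real ((norm z)\<^sup>2)"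
  unfolding herm_def norm_vec_L2 L2_set_def
  by (simp only: real_sqrt_pow2[OF sum_nonneg] zero_le_power2 of_real_sum complex_norm_square)

lemma norm_sq_herm: "(norm z)\<^sup>2 = Re (herm z z)"
  by (simp add: herm_self)

lemma herm_bound: "cmod (herm z w) \<le> norm z * norm w"
proof -
  have "cmod (herm z w) \<le> (\<Sum>i\<in>UNIV. \<bar>cmod (z $ i)\<bar> * \<bar>cmod (w $ i)\<bar>)"
    unfolding herm_def by (rule order_trans[OF norm_sum]) (simp add: norm_mult)
  also have "\<dots> \<le> norm z * norm w"
    unfolding norm_vec_L2 by (rule L2_set_mult_ineq)
  finally show ?thesis .
qed

lemma norm_scale: "norm (c *s (z :: complex ^ 'n)) = cmod c * norm z"
proof (rule power2_eq_imp_eq)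
  have "complex_of_real ((norm (c *s z))\<^sup>2) = of_real ((cmod c * norm z)\<^sup>2)"
    unfolding herm_self[symmetric] herm_simps power_mult_distrib of_real_mult
    by (simp only: complex_norm_square mult.assoc mult.left_commute)
  then show "(norm (c *s z))\<^sup>2 = (cmod c * norm z)\<^sup>2"
    by (simp only: of_real_eq_iff)
qed simp_all

lemma scale_of_real: "of_real r *s (z :: complex ^ 'n) = r *\<^sub>R z"
  by (simp add: Finite_Cartesian_Product.vec_eq_iff) (simp add: scaleR_conv_of_real)

lemma herm_less_1:
  assumes "z \<in> unit_ball" "w \<in> unit_ball"
  shows "cmod (herm z w) < 1"
proof -
  have "norm z * norm w \<le> norm z * 1"
    using assms by (intro mult_left_mono) auto
  then show ?thesis
    using herm_bound[of z w] assms by simp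
qed

lemma herm_neq_1:
  assumes "z \<in> unit_ball" "w \<in> unit_ball"
  shows "1 - herm z w \<noteq> 0"
  using herm_less_1[OF assms] by auto

lemma bounded_linear_herm_left: "bounded_linear (\<lambda>z. herm z w)"
proof
  show "herm (r *\<^sub>R z) w = r *\<^sub>R herm z w" for r z
    unfolding scale_of_real[symmetric] herm_simps by (simp add: scaleR_conv_of_real)
  show "\<exists>K. \<forall>z. norm (herm z w) \<le> norm z * K"
    using herm_bound by blast
qed (rule herm_add_left)

section \<open>Holomorphic maps and automorphisms of the ball\<close>

text \<open>Holomorphy is defined coordinatewise; assembling the coordinate derivatives into one
  complex homogeneous derivative makes the chain rule available.\<close>

lemma holo_map_on_iff:
  fixes f :: "complex ^ 'n \<Rightarrow> complex ^ 'm"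
  shows "holo_map_on f S \<longleftrightarrow>
    (\<forall>z\<in>S. \<exists>D. (f has_derivative D) (at z) \<and> (\<forall>c v. D (c *s v) = c *s D v))"
proof
  assume f: "holo_map_on f S"
  show "\<forall>z\<in>S. \<exists>D. (f has_derivative D) (at z) \<and> (\<forall>c v. D (c *s v) = c *s D v)"
  proof
    fix z assume "z \<in> S"
    then have "\<forall>i. \<exists>D. ((\<lambda>z. f z $ i) has_derivative D) (at z) \<and> (\<forall>c v. D (c *s v) = c * D v)"
      using f unfolding holo_map_on_def holo_fun_on_def by blast
    then obtain D where D: "\<And>i. ((\<lambda>z. f z $ i) has_derivative D i) (at z)"
      and lin: "\<And>i c v. D i (c *s v) = c * D i v"
      by metis
    have "(f has_derivative (\<lambda>v. \<chi> i. D i v)) (at z)"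
      by (subst has_derivative_componentwise_within)
        (auto simp: Basis_vec_def inner_axis intro!: has_derivative_inner_left D)
    then show "\<exists>D. (f has_derivative D) (at z) \<and> (\<forall>c v. D (c *s v) = c *s D v)"
      by (intro exI[of _ "\<lambda>v. \<chi> i. D i v"]) (auto simp: lin Finite_Cartesian_Product.vec_eq_iff)
  qed
next
  assume f: "\<forall>z\<in>S. \<exists>D. (f has_derivative D) (at z) \<and> (\<forall>c v. D (c *s v) = c *s D v)"
  show "holo_map_on f S"
    unfolding holo_map_on_def holo_fun_on_def
  proof (intro allI ballI)
    fix i z assume "z \<in> S"
    with f obtain D where D: "(f has_derivative D) (at z)" "\<forall>c v. D (c *s v) = c *s D v"
      by blast
    show "\<exists>D. ((\<lambda>z. f z $ i) has_derivative D) (at z) \<and> (\<forall>c v. D (c *s v) = c * D v)"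
      by (intro exI[of _ "\<lambda>v. D v $ i"])
        (simp add: D bounded_linear.has_derivative[OF bounded_linear_vec_nth D(1)])
  qed
qed

lemma holo_map_on_comp:
  assumes "holo_map_on f S" "holo_map_on g T" "f ` S \<subseteq> T"
  shows "holo_map_on (g \<circ> f) S"
  unfolding holo_map_on_iff
proof
  fix z assume z: "z \<in> S"
  obtain D where D: "(f has_derivative D) (at z)" "\<And>c v. D (c *s v) = c *s D v"
    using assms(1) z unfolding holo_map_on_iff by blast
  obtain E where E: "(g has_derivative E) (at (f z))" "\<And>c v. E (c *s v) = c *s E v"
    using assms(2,3) z unfolding holo_map_on_iff by blast
  have "(g \<circ> f has_derivative E \<circ> D) (at z)"
    by (rule diff_chain_at[OF D(1) E(1)])
  then show "\<exists>D. (g \<circ> f has_derivative D) (at z) \<and> (\<forall>c v. D (c *s v) = c *s D v)"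
    by (intro exI[of _ "E \<circ> D"]) (simp add: D E)
qed

lemma holo_map_on_transform:
  assumes "holo_map_on f S" "open S" "\<And>z. z \<in> S \<Longrightarrow> f z = g z"
  shows "holo_map_on g S"
  unfolding holo_map_on_iff
proof
  fix z assume z: "z \<in> S"
  obtain D where D: "(f has_derivative D) (at z)" "\<forall>c v. D (c *s v) = c *s D v"
    using assms(1) z unfolding holo_map_on_iff by blast
  have "(g has_derivative D) (at z)"
    by (rule has_derivative_transform_within_open[OF D(1) assms(2) z assms(3)])
  with D(2) show "\<exists>D. (g has_derivative D) (at z) \<and> (\<forall>c v. D (c *s v) = c *s D v)"
    by blast
qed

text \<open>An explicit inverse \<open>g\<close> agrees with \<open>inv_into unit_ball f\<close> on
  the ball, and on an open set holomorphy depends only on the values there.\<close>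

lemma ball_autI:
  assumes "holo_map_on f unit_ball" "holo_map_on g unit_ball"
    and "\<And>z. z \<in> unit_ball \<Longrightarrow> f z \<in> unit_ball" "\<And>z. z \<in> unit_ball \<Longrightarrow> g z \<in> unit_ball"
    and "\<And>z. z \<in> unit_ball \<Longrightarrow> g (f z) = z" "\<And>z. z \<in> unit_ball \<Longrightarrow> f (g z) = z"
  shows "f \<in> ball_aut"
proof -
  have bij: "bij_betw f unit_ball unit_ball"
    by (rule bij_betw_byWitness[of _ g]) (use assms in auto)
  have "g z = inv_into unit_ball f z" if "z \<in> unit_ball" for z
    using that assms(4,6) bij_betw_inv_into_left[OF bij, of "g z"] by simp
  then have "holo_map_on (inv_into unit_ball f) unit_ball"
    by (intro holo_map_on_transform[OF assms(2)]) auto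
  with bij assms(1) show ?thesis
    by (simp add: ball_aut_def)
qed

lemma ball_autE:
  assumes "f \<in> ball_aut"
  obtains g where "g \<in> ball_aut" "\<And>z. z \<in> unit_ball \<Longrightarrow> g (f z) = z"
    "\<And>z. z \<in> unit_ball \<Longrightarrow> f (g z) = z"
proof
  let ?g = "inv_into unit_ball f"
  have bij: "bij_betw f unit_ball unit_ball" and holo: "holo_map_on f unit_ball"
    "holo_map_on ?g unit_ball"
    using assms by (auto simp: ball_aut_def)
  show 1: "?g (f z) = z" if "z \<in> unit_ball" for z
    using bij that by (rule bij_betw_inv_into_left)
  show 2: "f (?g z) = z" if "z \<in> unit_ball" for z
    using bij that by (rule bij_betw_inv_into_right)
  show "?g \<in> ball_aut"
    by (rule ball_autI[OF holo(2,1)])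
      (use 1 2 bij_betwE[OF bij] bij_betwE[OF bij_betw_inv_into[OF bij]] in auto)
qed

lemma ball_aut_in_ball: "f \<in> ball_aut \<Longrightarrow> z \<in> unit_ball \<Longrightarrow> f z \<in> unit_ball"
  unfolding ball_aut_def by (auto dest: bij_betwE)

lemma ball_aut_holo: "f \<in> ball_aut \<Longrightarrow> holo_map_on f unit_ball"
  by (simp add: ball_aut_def)

lemma ball_aut_comp:
  assumes f: "f \<in> ball_aut" and g: "g \<in> ball_aut"
  shows "g \<circ> f \<in> ball_aut"
proof -
  obtain f' where f': "f' \<in> ball_aut" "\<And>z. z \<in> unit_ball \<Longrightarrow> f' (f z) = z"
    "\<And>z. z \<in> unit_ball \<Longrightarrow> f (f' z) = z" using ball_autE[OF f] by blast
  obtain g' where g': "g' \<in> ball_aut" "\<And>z. z \<in> unit_ball \<Longrightarrow> g' (g z) = z"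
    "\<And>z. z \<in> unit_ball \<Longrightarrow> g (g' z) = z" using ball_autE[OF g] by blast
  show ?thesis
  proof (rule ball_autI)
    show "holo_map_on (g \<circ> f) unit_ball"
      by (rule holo_map_on_comp[OF ball_aut_holo[OF f] ball_aut_holo[OF g]])
        (use ball_aut_in_ball[OF f] in blast)
    show "holo_map_on (f' \<circ> g') unit_ball"
      by (rule holo_map_on_comp[OF ball_aut_holo[OF g'(1)] ball_aut_holo[OF f'(1)]])
        (use ball_aut_in_ball[OF g'(1)] in blast)
  qed (simp_all add: ball_aut_in_ball f g f' g' del: mem_ball mem_ball_0)
qed

section \<open>Unitary maps\<close>

definition unitary_map :: "(complex ^ 'n \<Rightarrow> complex ^ 'n) \<Rightarrow> bool" where
  "unitary_map U \<longleftrightarrow> (\<forall>z w. U (z + w) = U z + U w) \<and> (\<forall>c z. U (c *s z) = c *s U z) \<and>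
     (\<forall>z w. herm (U z) (U w) = herm z w)"

lemma unitary_map_norm: "unitary_map U \<Longrightarrow> norm (U z) = norm z"
  by (rule power2_eq_imp_eq) (simp_all add: norm_sq_herm unitary_map_def)

lemma unitary_map_linear:
  assumes "unitary_map U" shows "linear U"
proof
  show "U (r *\<^sub>R z) = r *\<^sub>R U z" for r z
    using assms unfolding unitary_map_def scale_of_real[symmetric] by blast
qed (use assms in \<open>auto simp: unitary_map_def\<close>)

lemma unitary_map_holo:
  assumes "unitary_map U" shows "holo_map_on U S"
  unfolding holo_map_on_iff
proof
  fix z :: "complex ^ 'a"
  have "(U has_derivative U) (at z)"
    by (rule bounded_linear_imp_has_derivative[OF linear_conv_bounded_linear[THEN iffD1,
          OF unitary_map_linear[OF assms]]])
  then show "\<exists>D. (U has_derivative D) (at z) \<and> (\<forall>c v. D (c *s v) = c *s D v)"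
    using assms unfolding unitary_map_def by blast
qed

lemma unitary_map_comp: "unitary_map U \<Longrightarrow> unitary_map V \<Longrightarrow> unitary_map (V \<circ> U)"
  by (simp add: unitary_map_def)

text \<open>Preserving norms gives injectivity, and finite dimension gives surjectivity. The inverse
  inherits the three laws by applying \<open>U\<close> to both sides.\<close>

lemma unitary_map_ball_aut:
  assumes U: "unitary_map U" shows "U \<in> ball_aut"
proof -
  have inj: "inj U"
    unfolding linear_injective_0[OF unitary_map_linear[OF U]]
    using unitary_map_norm[OF U] by (metis norm_eq_zero)
  have surj: "surj U"
    by (rule eucl.linear_inj_imp_surj[OF unitary_map_linear[OF U] inj])
  have UV: "U (inv_into UNIV U z) = z" for z
    using surj by (simp add: surj_f_inv_f)
  have V: "unitary_map (inv_into UNIV U)"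
    unfolding unitary_map_def
  proof (intro conjI allI)
    fix z w c
    show "inv_into UNIV U (z + w) = inv_into UNIV U z + inv_into UNIV U w"
      by (rule injD[OF inj]) (use U in \<open>simp add: unitary_map_def UV\<close>)
    show "inv_into UNIV U (c *s z) = c *s inv_into UNIV U z"
      by (rule injD[OF inj]) (use U in \<open>simp add: unitary_map_def UV\<close>)
    have "herm (U (inv_into UNIV U z)) (U (inv_into UNIV U w)) = herm (inv_into UNIV U z) (inv_into UNIV U w)"
      using U unfolding unitary_map_def by blast
    then show "herm (inv_into UNIV U z) (inv_into UNIV U w) = herm z w" by (simp add: UV)
  qed
  show ?thesis
    by (rule ball_autI[OF unitary_map_holo[OF U] unitary_map_holo[OF V]])
      (simp_all add: unitary_map_norm U V inj UV)
qed

text \<open>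
  The involution exchanging \<open>0\<close> and \<open>a\<close>. Writing the projection to the line through \<open>a\<close>
  with the factor \<open>(1 - s) / (norm a)\<^sup>2 = 1 / (1 + s)\<close> makes the formula valid at \<open>a = 0\<close> too.
\<close>

definition ball_involution :: "complex ^ 'n \<Rightarrow> complex ^ 'n \<Rightarrow> complex ^ 'n" where
  "ball_involution a z = (let s = complex_of_real (sqrt (1 - (norm a)\<^sup>2)) in
     (1 / (1 - herm z a)) *s ((1 - herm z a / (1 + s)) *s a - s *s z))"

text \<open>Hides the square root: later computations see only a number \<open>s\<close> with
  algebraic relations, so they become identities of rational functions.\<close>

lemma ball_involution_aux:
  assumes "a \<in> unit_ball"
  obtains s :: complex where "s \<noteq> 0" "1 + s \<noteq> 0" "cnj s = s" "herm a a = 1 - s\<^sup>2"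
    "\<And>z. ball_involution a z = (1 / (1 - herm z a)) *s ((1 - herm z a / (1 + s)) *s a - s *s z)"
proof
  let ?r = "sqrt (1 - (norm a)\<^sup>2)"
  have "(norm a)\<^sup>2 < 1" using assms by (simp add: abs_square_less_1)
  then have r: "?r > 0" and r2: "?r\<^sup>2 = 1 - (norm a)\<^sup>2" by simp_all
  show "complex_of_real ?r \<noteq> 0" using r by simp
  have "complex_of_real (1 + ?r) \<noteq> 0" using r by (simp only: of_real_eq_0_iff)
  then show "1 + complex_of_real ?r \<noteq> 0" by simp
  show "cnj (complex_of_real ?r) = complex_of_real ?r" by simp
  show "herm a a = 1 - (complex_of_real ?r)\<^sup>2"
    unfolding herm_self of_real_power[symmetric] r2 by simp
  show "ball_involution a z = (1 / (1 - herm z a)) *s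
      ((1 - herm z a / (1 + complex_of_real ?r)) *s a - complex_of_real ?r *s z)" for z
    by (simp add: ball_involution_def Let_def)
qed

lemma ball_involution_self:
  assumes a: "a \<in> unit_ball" shows "ball_involution a a = 0"
proof -
  obtain s where s: "s \<noteq> 0" "1 + s \<noteq> 0" "cnj s = s" "herm a a = 1 - s\<^sup>2"
    "\<And>z. ball_involution a z = (1 / (1 - herm z a)) *s ((1 - herm z a / (1 + s)) *s a - s *s z)"
    using ball_involution_aux[OF a] by metis
  have "1 - (1 - s\<^sup>2) / (1 + s) = s"
    using s(2) by (simp add: divide_simps power2_eq_square algebra_simps)
  then show ?thesis by (simp add: s(5) s(4))
qed

lemma ball_involution_herm:
  assumes a: "a \<in> unit_ball" and z: "z \<in> unit_ball" and w: "w \<in> unit_ball"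
  shows "1 - herm (ball_involution a z) (ball_involution a w) =
    (1 - herm a a) * (1 - herm z w) / ((1 - herm z a) * (1 - herm a w))"
proof -
  obtain s where s: "s \<noteq> 0" "1 + s \<noteq> 0" "cnj s = s" "herm a a = 1 - s\<^sup>2"
    "\<And>z. ball_involution a z = (1 / (1 - herm z a)) *s ((1 - herm z a / (1 + s)) *s a - s *s z)"
    using ball_involution_aux[OF a] by metis
  define t u q where "t = herm z a" and "u = herm a w" and "q = herm z w"
  have nz: "1 - t \<noteq> 0" "1 - u \<noteq> 0"
    unfolding t_def u_def using herm_neq_1 a z w by blast+
  have cu: "cnj (herm w a) = u" by (simp add: cnj_herm u_def)
  \<comment> \<open>The coefficients are kept as variables, so that expanding the form does not
    unfold the fractions.\<close>
  have gen: "herm ((1 / c) *s (\<alpha> *s a - s *s z)) ((1 / d) *s (\<beta> *s a - s *s w)) =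
      (\<alpha> * (cnj \<beta> * (1 - s\<^sup>2) - s * u) - s * (cnj \<beta> * t - s * q)) / (c * cnj d)" for c d \<alpha> \<beta>
    unfolding herm_simps s(3,4) t_def[symmetric] u_def[symmetric] q_def[symmetric]
    by (simp add: divide_inverse) (simp add: algebra_simps)
  have eq: "herm (ball_involution a z) (ball_involution a w) =
    ((1 - t / (1 + s)) * ((1 - u / (1 + s)) * (1 - s\<^sup>2) - s * u)
      - s * ((1 - u / (1 + s)) * t - s * q)) / ((1 - t) * (1 - u))"
    unfolding s(5) gen by (simp add: s(3) cu t_def[symmetric])
  \<comment> \<open>Naming \<open>1 + s\<close> makes the denominator a variable for
    \<open>divide_simps\<close>; afterwards \<open>s\<close> is eliminated as
    \<open>p - 1\<close>.\<close>
  define p where "p = 1 + s"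
  have sp: "s = p - 1" by (simp add: p_def)
  have "(1 - t) * (1 - u) - ((1 - t / p) * ((1 - u / p) * (1 - s\<^sup>2) - s * u)
      - s * ((1 - u / p) * t - s * q)) = s\<^sup>2 * (1 - q)"
    using s(2) unfolding p_def[symmetric] unfolding sp
    by (simp add: divide_simps) (simp add: algebra_simps power2_eq_square)
  then have "1 - herm (ball_involution a z) (ball_involution a w) = s\<^sup>2 * (1 - q) / ((1 - t) * (1 - u))"
    unfolding eq p_def using nz by (simp add: divide_simps)
  then show ?thesis by (simp add: s(4) t_def u_def q_def)
qed

text \<open>On the diagonal \<open>w = z\<close> the product formula expresses
  \<open>1 - (norm (ball_involution a z))\<^sup>2\<close> as a quotient of positive numbers.\<close>

lemma ball_involution_in_ball:
  assumes a: "a \<in> unit_ball" and z: "z \<in> unit_ball"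
  shows "ball_involution a z \<in> unit_ball"
proof -
  have pos: "(norm x)\<^sup>2 < 1" if "x \<in> unit_ball" for x :: "complex ^ 'n"
    using that by (simp add: abs_square_less_1)
  have "1 - herm (ball_involution a z) (ball_involution a z) =
    (1 - herm a a) * (1 - herm z z) / ((1 - herm z a) * cnj (1 - herm z a))"
    using ball_involution_herm[OF a z z] by (simp add: cnj_herm)
  also have "\<dots> = of_real ((1 - (norm a)\<^sup>2) * (1 - (norm z)\<^sup>2) / (cmod (1 - herm z a))\<^sup>2)"
    unfolding herm_self complex_norm_square[symmetric] by simp
  finally have "complex_of_real (1 - (norm (ball_involution a z))\<^sup>2) =
      of_real ((1 - (norm a)\<^sup>2) * (1 - (norm z)\<^sup>2) / (cmod (1 - herm z a))\<^sup>2)"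
    by (simp add: herm_self)
  then have "1 - (norm (ball_involution a z))\<^sup>2 =
      (1 - (norm a)\<^sup>2) * (1 - (norm z)\<^sup>2) / (cmod (1 - herm z a))\<^sup>2"
    by (simp only: of_real_eq_iff)
  also have "\<dots> > 0"
    using pos[OF a] pos[OF z] herm_neq_1[OF z a] by (intro divide_pos_pos mult_pos_pos) auto
  finally show ?thesis by (simp add: abs_square_less_1)
qed

text \<open>The second application sees its argument only through its product with \<open>a\<close>,
  which is \<open>(1 - s\<^sup>2 - t) / (1 - t)\<close>, and through its coordinates; hence the
  check is a scalar identity in each coordinate.\<close>

lemma ball_involution_ball_involution:
  assumes a: "a \<in> unit_ball" and z: "z \<in> unit_ball"
  shows "ball_involution a (ball_involution a z) = z"
proof -
  obtain s where s: "s \<noteq> 0" "1 + s \<noteq> 0" "cnj s = s" "herm a a = 1 - s\<^sup>2"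
    "\<And>z. ball_involution a z = (1 / (1 - herm z a)) *s ((1 - herm z a / (1 + s)) *s a - s *s z)"
    using ball_involution_aux[OF a] by metis
  define t where "t = herm z a"
  have nz: "1 - t \<noteq> 0"
    unfolding t_def using herm_neq_1 a z by blast
  define p where "p = 1 + s"
  have sp: "s = p - 1" by (simp add: p_def)
  have p: "p \<noteq> 0" using s(2) by (simp add: p_def)
  have "herm (ball_involution a z) a = ((1 - t / p) * (1 - s\<^sup>2) - s * t) / (1 - t)"
    unfolding s(5) herm_simps s(4) t_def[symmetric] p_def by simp
  also have "(1 - t / p) * (1 - s\<^sup>2) - s * t = 1 - s\<^sup>2 - t"
    using p unfolding sp by (simp add: divide_simps) (simp add: algebra_simps power2_eq_square)
  finally have h: "herm (ball_involution a z) a = (1 - s\<^sup>2 - t) / (1 - t)" .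
  have h1: "1 / (1 - herm (ball_involution a z) a) = (1 - t) / s\<^sup>2"
    unfolding h using nz s(1) by (simp add: divide_simps)
  show ?thesis
  proof (subst Finite_Cartesian_Product.vec_eq_iff, rule allI)
    fix i
    have "ball_involution a (ball_involution a z) $ i =
      (1 - t) / s\<^sup>2 * ((1 - (1 - s\<^sup>2 - t) / (1 - t) / p) * a $ i
        - s * (1 / (1 - t) * ((1 - t / p) * a $ i - s * z $ i)))"
      by (subst s(5), subst h1, subst h)
        (simp only: s(5) t_def[symmetric] p_def[symmetric] vector_minus_component vector_smult_component)
    also have "\<dots> = z $ i"
      using nz p s(1) by (simp add: divide_simps) (simp add: sp algebra_simps power2_eq_square)
    finally show "ball_involution a (ball_involution a z) $ i = z $ i" .
  qed
qed

lemma holo_ball_involution: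
  assumes a: "(a :: complex ^ 'n) \<in> unit_ball"
  shows "holo_map_on (ball_involution a) unit_ball"
  unfolding holo_map_on_def holo_fun_on_def
proof (intro allI ballI)
  fix i and z :: "complex ^ 'n" assume z: "z \<in> unit_ball"
  obtain s where s: "\<And>z. ball_involution a z = (1 / (1 - herm z a)) *s ((1 - herm z a / (1 + s)) *s a - s *s z)"
    using ball_involution_aux[OF a] by metis
  have eq: "(\<lambda>z. ball_involution a z $ i) =
      (\<lambda>z. ((1 - herm z a * (1 / (1 + s))) * a $ i - s * z $ i) / (1 - herm z a))"
    by (simp only: s vector_minus_component vector_smult_component) simp
  have 1: "((\<lambda>z. herm z a) has_derivative (\<lambda>v. herm v a)) (at z)"
    by (rule bounded_linear_imp_has_derivative[OF bounded_linear_herm_left])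
  have 2: "((\<lambda>z. z $ i) has_derivative (\<lambda>v. v $ i)) (at z)"
    by (rule bounded_linear_imp_has_derivative[OF bounded_linear_vec_nth])
  have nz: "1 - herm z a \<noteq> 0" by (rule herm_neq_1[OF z a])
  show "\<exists>D. ((\<lambda>z. ball_involution a z $ i) has_derivative D) (at z) \<and> (\<forall>c v. D (c *s v) = c * D v)"
    unfolding eq
    by (rule exI, rule conjI, (rule derivative_eq_intros 1 2 nz refl)+)
      (simp add: herm_simps algebra_simps diff_divide_distrib add_divide_distrib)
qed

lemma ball_involution_ball_aut: "a \<in> unit_ball \<Longrightarrow> ball_involution a \<in> ball_aut"
  by (rule ball_autI[of _ "ball_involution a"])
    (simp_all add: holo_ball_involution ball_involution_ball_involution ball_involution_in_ball
      del: mem_ball mem_ball_0)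

section \<open>Schwarz lemma on slices and automorphisms fixing the origin\<close>

lemma holomorphic_on_slice:
  assumes f: "holo_map_on f unit_ball" and v: "norm v \<le> 1"
  shows "(\<lambda>c. herm (f (c *s v)) w) holomorphic_on ball 0 1"
  unfolding holomorphic_on_def field_differentiable_def
proof
  fix c :: complex assume "c \<in> ball 0 1"
  then have "cmod c * norm v < 1"
    using v by (smt (verit) mem_ball_0 mult_left_le norm_ge_zero)
  then have "c *s v \<in> unit_ball" by (simp add: norm_scale)
  then obtain D where D: "(f has_derivative D) (at (c *s v))" "\<And>c v. D (c *s v) = c *s D v"
    using f unfolding holo_map_on_iff by blast
  have "bounded_linear (\<lambda>c. c *s v)"
  proof
    show "(b1 + b2) *s v = b1 *s v + b2 *s v" for b1 b2
      by (rule vector_sadd_rdistrib)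
    show "(r *\<^sub>R b) *s v = r *\<^sub>R (b *s v)" for r b
      by (simp add: Finite_Cartesian_Product.vec_eq_iff)
    show "\<exists>K. \<forall>x. norm (x *s v) \<le> norm x * K"
      using norm_scale by (metis order_refl)
  qed
  then have "((\<lambda>c. c *s v) has_derivative (\<lambda>c. c *s v)) (at c)"
    by (rule bounded_linear_imp_has_derivative)
  from diff_chain_at[OF this D(1)]
  have "((\<lambda>c. f (c *s v)) has_derivative (\<lambda>c. D (c *s v))) (at c)"
    by (simp add: o_def)
  \<comment> \<open>Complex homogeneity of \<open>D\<close> turns the real derivative into
    multiplication by the number \<open>herm (D v) w\<close>, that is, into a complex
    derivative.\<close>
  from bounded_linear.has_derivative[OF bounded_linear_herm_left this]
  have "((\<lambda>c. herm (f (c *s v)) w) has_derivative (\<lambda>c. herm (D v) w * c)) (at c)"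
    by (simp add: D(2) herm_scale_left mult.commute)
  then have "((\<lambda>c. herm (f (c *s v)) w) has_field_derivative herm (D v) w) (at c)"
    by (simp add: has_field_derivative_def)
  then show "\<exists>d. ((\<lambda>c. herm (f (c *s v)) w) has_field_derivative d) (at c within ball 0 1)"
    using has_field_derivative_at_within by blast
qed

lemma slice_bound:
  assumes "\<And>z. z \<in> unit_ball \<Longrightarrow> f z \<in> unit_ball" "norm v \<le> 1" "norm w \<le> 1" "norm c < 1"
  shows "cmod (herm (f (c *s v)) w) < 1"
proof -
  have "cmod c * norm v < 1"
    using assms by (smt (verit) mult_left_le norm_ge_zero)
  then have "norm (f (c *s v)) < 1" using assms(1)[of "c *s v"] by (simp add: norm_scale)
  moreover have "norm (f (c *s v)) * norm w \<le> norm (f (c *s v))"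
    using assms(3) by (simp add: mult_left_le)
  ultimately show ?thesis using herm_bound[of "f (c *s v)" w] by linarith
qed

text \<open>Pairing with the unit vector \<open>w\<close> in the direction of \<open>f z\<close>
  reduces the claim to one variable: the slice function takes the value \<open>norm (f z)\<close> at
  the point \<open>norm z\<close> of the disc.\<close>

lemma schwarz_ball:
  assumes f: "holo_map_on f unit_ball" "\<And>z. z \<in> unit_ball \<Longrightarrow> f z \<in> unit_ball" "f 0 = 0"
    and z: "z \<in> unit_ball"
  shows "norm (f z) \<le> norm z"
proof (cases "z = 0 \<or> f z = 0")
  case True
  then show ?thesis using f(3) by auto
next
  case False
  define v where "v = (1 / of_real (norm z)) *s z"
  define w where "w = (1 / of_real (norm (f z))) *s f z"
  have v: "norm v = 1" "of_real (norm z) *s v = z"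
    using False by (simp_all add: v_def norm_scale norm_divide)
  have w: "norm w = 1" using False by (simp add: w_def norm_scale norm_divide)
  have "cmod (herm (f (of_real (norm z) *s v)) w) \<le> cmod (of_real (norm z))"
    by (rule Schwarz_Lemma(1)[OF holomorphic_on_slice[OF f(1)]])
      (use v w f(3) z slice_bound[OF f(2), where v = v and w = w] in \<open>simp_all add: herm_simps\<close>)
  moreover have "herm (f z) w = of_real (norm (f z))"
    using False by (simp add: w_def herm_simps herm_self power2_eq_square)
  ultimately show ?thesis by (simp add: v)
qed

text \<open>The Schwarz bound applies to \<open>f\<close> and to its inverse, which also fixes
  \<open>0\<close>.\<close>

lemma ball_aut_fix_0_norm:
  assumes f: "f \<in> ball_aut" "f 0 = 0" and z: "z \<in> unit_ball"
  shows "norm (f z) = norm z"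
proof -
  obtain g where g: "g \<in> ball_aut" "\<And>z. z \<in> unit_ball \<Longrightarrow> g (f z) = z" using ball_autE[OF f(1)] by metis
  have g0: "g 0 = 0" using g(2)[of 0] f(2) by simp
  have "norm (g (f z)) \<le> norm (f z)"
    by (rule schwarz_ball[OF ball_aut_holo[OF g(1)] ball_aut_in_ball[OF g(1)] g0 ball_aut_in_ball[OF f(1) z]])
  moreover have "norm (f z) \<le> norm z"
    by (rule schwarz_ball[OF ball_aut_holo[OF f(1)] ball_aut_in_ball[OF f(1)] f(2) z])
  ultimately show ?thesis using g(2)[OF z] by simp
qed

text \<open>
  Equality holds in the Schwarz lemma on the slice through \<open>z\<close>, paired with the direction of
  \<open>f z\<close>; together with \<open>norm (f z) = norm z\<close> this forces \<open>f\<close> to be linear on the slice.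
\<close>

lemma ball_aut_fix_0_slice:
  assumes f: "f \<in> ball_aut" "f 0 = 0" and z: "z \<in> unit_ball" and t: "\<bar>t\<bar> < 1"
  shows "f (t *\<^sub>R z) = t *\<^sub>R f z"
proof (cases "z = 0")
  case True
  then show ?thesis using f(2) by simp
next
  case False
  let ?r = "complex_of_real (norm z)"
  define v where "v = (1 / ?r) *s z"
  define w where "w = (1 / ?r) *s f z"
  have r: "?r \<noteq> 0" "cmod ?r < 1" using False z by auto
  have v: "norm v = 1" and zv: "?r *s v = z"
    using False by (simp_all add: v_def norm_scale norm_divide)
  have w: "norm w = 1" and fw: "?r *s w = f z"
    using False ball_aut_fix_0_norm[OF f z] by (simp_all add: w_def norm_scale norm_divide)
  let ?g = "\<lambda>c. herm (f (c *s v)) w"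
  have gr: "?g ?r = ?r"
    unfolding zv unfolding fw[symmetric] herm_scale_left using w by (simp add: herm_self)
  have "\<exists>\<alpha>. (\<forall>c. cmod c < 1 \<longrightarrow> ?g c = \<alpha> * c) \<and> cmod \<alpha> = 1"
  proof (rule Schwarz_Lemma(3)[where f = ?g and \<xi> = 0])
    show "?g holomorphic_on ball 0 1"
      using holomorphic_on_slice[OF ball_aut_holo[OF f(1)]] v by simp
    show "?g 0 = 0" using f(2) by (simp add: herm_simps)
    show "cmod (?g c) < 1" if "cmod c < 1" for c
      by (rule slice_bound[OF ball_aut_in_ball[OF f(1)]]) (use v w that in simp_all)
    show "(\<exists>c. cmod c < 1 \<and> c \<noteq> 0 \<and> cmod (?g c) = cmod c) \<or> cmod (deriv ?g 0) = 1"
      using r gr by (intro disjI1 exI[of _ ?r]) simp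
  qed simp
  then obtain \<alpha> where \<alpha>: "\<And>c. cmod c < 1 \<Longrightarrow> ?g c = \<alpha> * c" by blast
  \<comment> \<open>The rigid case yields a rotation; its value at \<open>norm z\<close> fixes the
    factor.\<close>
  have "\<alpha> = 1" using \<alpha>[OF r(2)] gr r(1) by simp
  define c where "c = complex_of_real (t * norm z)"
  have "\<bar>t\<bar> * norm z \<le> 1 * norm z" using t by (intro mult_right_mono) auto
  then have c: "cmod c < 1" using z by (simp add: c_def norm_mult)
  have "c *s v = of_real t *s (?r *s v)" "c *s w = of_real t *s (?r *s w)"
    by (simp_all add: c_def)
  then have cv: "c *s v = t *\<^sub>R z" "c *s w = t *\<^sub>R f z"
    unfolding zv fw by (simp_all only: scale_of_real)
  have gc: "herm (f (c *s v)) w = c" using \<alpha>[OF c] \<open>\<alpha> = 1\<close> by simp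
  have "norm (f (c *s v)) = cmod c"
    using ball_aut_fix_0_norm[OF f, of "c *s v"] c v by (simp add: norm_scale)
  then have "herm (f (c *s v)) (f (c *s v)) = c * cnj c"
    unfolding herm_self by (simp only: complex_norm_square)
  moreover have "herm w (f (c *s v)) = cnj c"
    using cnj_herm[of "f (c *s v)" w] gc by simp
  moreover have "herm w w = 1" using w by (simp add: herm_self)
  \<comment> \<open>Each of the four products in the expansion equals \<open>c * cnj c\<close>, so
    they cancel.\<close>
  ultimately have "herm (f (c *s v) - c *s w) (f (c *s v) - c *s w) = 0"
    unfolding herm_simps gc by simp
  then have "f (c *s v) - c *s w = 0"
    unfolding herm_self by simp
  then show ?thesis by (simp add: cv)
qed

text \<open>Since \<open>f\<close> is homogeneous along radii, it coincides on the ball with its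
  derivative \<open>D\<close> at \<open>0\<close>. By scaling, \<open>D\<close> preserves all norms;
  polarisation gives the real part of the products, and replacing \<open>z\<close> by
  \<open>(- \<i>) *s z\<close> gives the imaginary part.\<close>

lemma ball_aut_fix_0_herm:
  assumes f: "f \<in> ball_aut" "f 0 = 0"
    and z: "(z :: complex ^ 'n) \<in> unit_ball" and w: "w \<in> unit_ball"
  shows "herm (f z) (f w) = herm z w"
proof -
  have "(0 :: complex ^ 'n) \<in> unit_ball" by simp
  from ball_aut_holo[OF f(1), unfolded holo_map_on_iff, THEN bspec, OF this]
  obtain D where D: "(f has_derivative D) (at 0)" "\<And>c v. D (c *s v) = c *s D v"
    by auto
  interpret D: bounded_linear D by (rule has_derivative_bounded_linear[OF D(1)])
  have fD: "f x = D x" if x: "x \<in> unit_ball" for x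
  proof -
    have "((\<lambda>t :: real. t *\<^sub>R x) has_derivative (\<lambda>t. t *\<^sub>R x)) (at 0)"
      by (rule bounded_linear_imp_has_derivative[OF bounded_linear_scaleR_left])
    from diff_chain_at[OF this] D(1)
    have "((\<lambda>t. f (t *\<^sub>R x)) has_derivative (\<lambda>t. D (t *\<^sub>R x))) (at 0)"
      by (simp add: o_def)
    moreover have "((\<lambda>t. f (t *\<^sub>R x)) has_derivative (\<lambda>t. t *\<^sub>R f x)) (at 0)"
    proof (rule has_derivative_transform_within_open)
      show "((\<lambda>t. t *\<^sub>R f x) has_derivative (\<lambda>t. t *\<^sub>R f x)) (at (0 :: real))"
        by (rule bounded_linear_imp_has_derivative[OF bounded_linear_scaleR_left])
      show "open {-1 <..< 1 :: real}" by simp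
      show "t *\<^sub>R f x = f (t *\<^sub>R x)" if "t \<in> {-1<..<1}" for t :: real
        using ball_aut_fix_0_slice[OF f x, of t] that by (simp add: abs_less_iff)
      show "0 \<in> {-1 <..< 1 :: real}" by simp
    qed
    ultimately have "(\<lambda>t. D (t *\<^sub>R x)) = (\<lambda>t. t *\<^sub>R f x)"
      by (rule has_derivative_unique)
    then have "D (1 *\<^sub>R x) = 1 *\<^sub>R f x" by meson
    then show ?thesis by simp
  qed
  have norm_D: "norm (D x) = norm x" for x :: "complex ^ 'n"
  proof -
    define r where "r = 1 / (norm x + 1)"
    have r: "r > 0" "r * norm x < 1" by (simp_all add: r_def divide_simps add_nonneg_pos)
    then have "r *\<^sub>R x \<in> unit_ball" by simp
    then have "norm (D (r *\<^sub>R x)) = norm (r *\<^sub>R x)"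
      using ball_aut_fix_0_norm[OF f, of "r *\<^sub>R x"] fD[of "r *\<^sub>R x"] by simp
    then show ?thesis using r by (simp add: D.scaleR)
  qed
  have re: "Re (herm (D x) (D y)) = Re (herm x y)" for x y :: "complex ^ 'n"
  proof -
    have "(norm (D (x + y)))\<^sup>2 = (norm (x + y))\<^sup>2" by (simp only: norm_D)
    moreover have "Re (herm b a) = Re (herm a b)" for a b :: "complex ^ 'n"
      unfolding cnj_herm[of a b, symmetric] by simp
    moreover have "(norm (D x))\<^sup>2 = (norm x)\<^sup>2" "(norm (D y))\<^sup>2 = (norm y)\<^sup>2"
      by (simp_all only: norm_D)
    ultimately show ?thesis
      by (simp add: norm_sq_herm D.add herm_simps)
  qed
  have "Im (herm (D z) (D w)) = Im (herm z w)"
    using re[of "(- \<i>) *s z" w] by (simp only: D(2) herm_simps) simp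
  with re[of z w] show ?thesis
    by (simp add: fD z w complex_eq_iff del: mem_ball mem_ball_0)
qed

section \<open>Normal forms\<close>

lemma coord_pos_strict_mono: "i < j \<Longrightarrow> coord_pos i < coord_pos j"
  unfolding coord_pos_def by (rule psubset_card_mono) auto

lemma coord_pos_inj: "coord_pos i = coord_pos j \<Longrightarrow> i = j"
  by (metis coord_pos_strict_mono linorder_neq_iff nat_neq_iff)

lemma coord_pos_pos: "0 < coord_pos i"
  by (auto simp: coord_pos_def card_gt_0_iff)

text \<open>The positions fill \<open>{1..CARD('n)}\<close>, so a coordinate beyond position
  \<open>m\<close> forces one at \<open>Suc m\<close>. This provides the axis for the next
  independent point.\<close>

lemma coord_pos_exists:
  fixes i :: "'n::{finite,linorder}"
  assumes "m < coord_pos i"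
  obtains j :: 'n where "coord_pos j = Suc m"
proof -
  have "range (coord_pos :: 'n \<Rightarrow> nat) = {1..CARD('n)}"
  proof (rule card_subset_eq)
    show "range (coord_pos :: 'n \<Rightarrow> nat) \<subseteq> {1..CARD('n)}"
      using coord_pos_pos by (auto simp: coord_pos_def card_mono Suc_le_eq)
    have "inj (coord_pos :: 'n \<Rightarrow> nat)" by (rule injI) (rule coord_pos_inj)
    then show "card (range (coord_pos :: 'n \<Rightarrow> nat)) = card {1..CARD('n)}"
      by (simp add: card_image)
  qed simp
  moreover have "Suc m \<le> CARD('n)"
    using assms card_mono[of UNIV "{..i}"] by (simp add: coord_pos_def)
  ultimately have "Suc m \<in> range (coord_pos :: 'n \<Rightarrow> nat)" by simp
  then show ?thesis using that by (metis imageE)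
qed

definition supported_upto :: "nat \<Rightarrow> complex ^ 'n::{finite,linorder} \<Rightarrow> bool" where
  "supported_upto m v \<longleftrightarrow> (\<forall>i. m < coord_pos i \<longrightarrow> v $ i = 0)"

text \<open>The orthogonal projection onto the span of the first \<open>m\<close> coordinate
  axes.\<close>

definition truncate_at ::
    "nat \<Rightarrow> complex ^ 'n::{finite,linorder} \<Rightarrow> complex ^ 'n::{finite,linorder}" where
  "truncate_at m v = (\<chi> i. if coord_pos i \<le> m then v $ i else 0)"

lemma truncate_at_nth [simp]: "truncate_at m v $ i = (if coord_pos i \<le> m then v $ i else 0)"
  by (simp add: truncate_at_def)

lemma supported_truncate_at: "supported_upto m (truncate_at m v)"
  by (simp add: supported_upto_def)

lemma herm_truncate_at: "supported_upto m x \<Longrightarrow> herm (truncate_at m v) x = herm v x"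
  unfolding herm_def by (rule sum.cong) (auto simp: supported_upto_def)

lemma herm_disjoint:
  assumes "supported_upto m x" "truncate_at m v = 0"
  shows "herm x v = 0"
proof -
  have "herm (truncate_at m v) x = 0" using assms(2) by (simp add: herm_simps)
  then show ?thesis using herm_truncate_at[OF assms(1), of v] cnj_herm[of v x] by simp
qed

lemma herm_axis: "herm v (axis i c) = v $ i * cnj c"
proof -
  have "herm v (axis i c) = (\<Sum>j\<in>UNIV. if j = i then v $ i * cnj c else 0)"
    unfolding herm_def by (rule sum.cong) (auto simp: axis_def)
  then show ?thesis by simp
qed

text \<open>Exposes the witness quantified in \<open>in_normal_form\<close>, so that two witnesses
  can be compared and one can be extended by a new point.\<close>

definition rank_profile :: "(nat \<Rightarrow> nat) \<Rightarrow> (complex ^ 'n::{finite,linorder}) list \<Rightarrow> bool" where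
  "rank_profile N xs \<longleftrightarrow> N 0 = 0 \<and>
     (\<forall>k. Suc k < length xs \<longrightarrow> N (Suc k) = N k \<or> N (Suc k) = N k + 1) \<and>
     (\<forall>k<length xs. supported_upto (N k) (xs ! k)) \<and>
     (\<forall>k. Suc k < length xs \<and> N k < N (Suc k) \<longrightarrow>
        (\<exists>i. coord_pos i = N (Suc k) \<and> (\<exists>a::real. a > 0 \<and> xs ! Suc k $ i = of_real a)))"

lemma in_normal_form_iff:
  "in_normal_form xs \<longleftrightarrow> set xs \<subseteq> unit_ball \<and> (xs \<noteq> [] \<longrightarrow> xs ! 0 = 0) \<and> (\<exists>N. rank_profile N xs)"
proof -
  have "(\<forall>k<length xs. xs ! k \<in> unit_ball) \<longleftrightarrow> set xs \<subseteq> unit_ball"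
    by (auto simp: set_conv_nth)
  then show ?thesis
    unfolding in_normal_form_def rank_profile_def supported_upto_def by simp
qed

lemma rank_profile_mono:
  assumes N: "rank_profile N xs" and "j \<le> k" "k < length xs"
  shows "N j \<le> N k"
  using assms(2,3)
proof (induction k rule: dec_induct)
  case (step k)
  have "N (Suc k) = N k \<or> N (Suc k) = N k + 1"
    using N step.prems unfolding rank_profile_def by blast
  then show ?case using step by auto
qed simp

lemma rank_profile_supported:
  assumes "rank_profile N xs" "j \<le> k" "k < length xs"
  shows "supported_upto (N k) (xs ! j)"
proof -
  have "supported_upto (N j) (xs ! j)" using assms unfolding rank_profile_def by simp
  then show ?thesis using rank_profile_mono[OF assms] by (auto simp: supported_upto_def)
qed

text \<open>Merges both kinds of step into one pivot \<open>a\<close>: the rank grows exactly when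
  \<open>a > 0\<close>, and \<open>a = 0\<close> means that the new point has no entry beyond the
  old rank.\<close>

lemma rank_profile_step:
  fixes xs :: "(complex ^ 'n::{finite,linorder}) list"
  assumes N: "rank_profile N xs" and k: "Suc k < length xs"
  obtains a :: real where "a \<ge> 0" "N (Suc k) = (if a > 0 then Suc (N k) else N k)"
    "\<And>i. N k < coord_pos i \<Longrightarrow> xs ! Suc k $ i = (if coord_pos i = Suc (N k) then of_real a else 0)"
    "a > 0 \<Longrightarrow> \<exists>i :: 'n. coord_pos i = Suc (N k)"
proof (cases "N (Suc k) = N k")
  case True
  have "supported_upto (N (Suc k)) (xs ! Suc k)"
    using N k unfolding rank_profile_def by blast
  then show ?thesis using that[of 0] True by (auto simp: supported_upto_def)
next
  case False
  then have Nk: "N (Suc k) = Suc (N k)"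
    using N k unfolding rank_profile_def by fastforce
  have sup: "supported_upto (N (Suc k)) (xs ! Suc k)"
    using N k unfolding rank_profile_def by blast
  have "N k < N (Suc k)" using Nk by simp
  then obtain i a where i: "coord_pos i = N (Suc k)" "a > (0::real)" "xs ! Suc k $ i = of_real a"
    using N k unfolding rank_profile_def by blast
  show ?thesis
  proof (rule that[of a])
    show "xs ! Suc k $ j = (if coord_pos j = Suc (N k) then of_real a else 0)"
      if "N k < coord_pos j" for j
      using that i sup coord_pos_inj[of j i] Nk unfolding supported_upto_def by auto
  qed (use i Nk in auto)
qed

text \<open>
  The third component of the induction hypothesis says that the first points span the
  coordinate subspace in which they lie.
\<close>

lemma normal_form_unique:
  fixes xs ys :: "(complex ^ 'n::{finite,linorder}) list"
  assumes "in_normal_form xs" "in_normal_form ys" and len: "length ys = length xs"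
    and gram: "\<And>i j. i < length xs \<Longrightarrow> j < length xs \<Longrightarrow> herm (xs ! i) (xs ! j) = herm (ys ! i) (ys ! j)"
  shows "xs = ys"
proof -
  obtain N M where N: "rank_profile N xs" and M: "rank_profile M ys"
    and zero: "xs \<noteq> [] \<longrightarrow> xs ! 0 = 0" "ys \<noteq> [] \<longrightarrow> ys ! 0 = 0"
    using assms(1,2) unfolding in_normal_form_iff by blast
  have "(\<forall>j\<le>k. xs ! j = ys ! j) \<and> N k = M k \<and>
      (\<forall>v. supported_upto (N k) v \<and> (\<forall>j\<le>k. herm v (xs ! j) = 0) \<longrightarrow> v = 0)"
    if "k < length xs" for k
    using that
  proof (induction k)
    case 0
    have "N 0 = 0" "M 0 = 0" using N M by (simp_all add: rank_profile_def)
    moreover have "v = 0" if "supported_upto 0 v" for v :: "complex ^ 'n::{finite,linorder}"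
      using that coord_pos_pos[where ?'a = 'n] by (simp add: supported_upto_def Finite_Cartesian_Product.vec_eq_iff)
    moreover have "xs \<noteq> []" "ys \<noteq> []" using 0 len by auto
    ultimately show ?case using zero by auto
  next
    case (Suc k)
    let ?x = "xs ! Suc k" and ?y = "ys ! Suc k" and ?m = "N k"
    from Suc have eq: "\<And>j. j \<le> k \<Longrightarrow> xs ! j = ys ! j" and NM: "N k = M k"
      and full: "\<And>v. supported_upto ?m v \<Longrightarrow> (\<And>j. j \<le> k \<Longrightarrow> herm v (xs ! j) = 0) \<Longrightarrow> v = 0"
      by auto
    have sup: "supported_upto ?m (xs ! j)" if "j \<le> k" for j
      using rank_profile_supported[OF N that] Suc.prems by simp
    \<comment> \<open>The projected difference is orthogonal to all earlier points because the Gram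
      matrices agree, and these points span the first \<open>?m\<close> axes.\<close>
    have tr: "truncate_at ?m (?x - ?y) = 0"
    proof (rule full[OF supported_truncate_at])
      fix j assume j: "j \<le> k"
      have "herm ?y (xs ! j) = herm ?y (ys ! j)" using eq[OF j] by simp
      then show "herm (truncate_at ?m (?x - ?y)) (xs ! j) = 0"
        unfolding herm_truncate_at[OF sup[OF j]] herm_simps
        using gram[of "Suc k" j] Suc.prems j by simp
    qed
    have low: "?x $ i = ?y $ i" if "coord_pos i \<le> ?m" for i
      using that arg_cong[OF tr, of "\<lambda>v. v $ i"] by simp
    obtain a where a: "a \<ge> 0" "N (Suc k) = (if a > 0 then Suc ?m else ?m)"
      "\<And>i. ?m < coord_pos i \<Longrightarrow> ?x $ i = (if coord_pos i = Suc ?m then of_real a else 0)"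
      "a > 0 \<Longrightarrow> \<exists>i :: 'n. coord_pos i = Suc ?m"
      using rank_profile_step[OF N Suc.prems] by metis
    obtain b where b: "b \<ge> 0" "M (Suc k) = (if b > 0 then Suc ?m else ?m)"
      "\<And>i. ?m < coord_pos i \<Longrightarrow> ?y $ i = (if coord_pos i = Suc ?m then of_real b else 0)"
      "b > 0 \<Longrightarrow> \<exists>i :: 'n. coord_pos i = Suc ?m"
      using rank_profile_step[OF M, of k] Suc.prems len NM by metis
    \<comment> \<open>Without a coordinate at position \<open>Suc ?m\<close> both pivots are
      \<open>0\<close>. Otherwise the new points share the part \<open>t\<close>, so equal norms
      give equal squares of the pivots.\<close>
    have ab: "a = b"
    proof (cases "\<exists>i :: 'n. coord_pos i = Suc ?m")
      case False
      then show ?thesis using a b by force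
    next
      case True
      then obtain i :: 'n where i: "coord_pos i = Suc ?m" by blast
      define t where "t = truncate_at ?m ?x"
      have decomp: "z = t + of_real c *s axis i 1"
        if "\<And>j. coord_pos j \<le> ?m \<Longrightarrow> z $ j = ?x $ j"
          "\<And>j. ?m < coord_pos j \<Longrightarrow> z $ j = (if coord_pos j = Suc ?m then of_real c else 0)" for z c
      proof (subst Finite_Cartesian_Product.vec_eq_iff, rule allI)
        fix j
        show "z $ j = (t + of_real c *s axis i 1) $ j"
        proof (cases "coord_pos j \<le> ?m")
          case True
          then have "j \<noteq> i" using i by auto
          then show ?thesis using that(1)[OF True] True by (simp add: t_def axis_def)
        next
          case False
          have "coord_pos j = Suc ?m \<longleftrightarrow> j = i" using i coord_pos_inj by metis
          with that(2)[of j] False have "z $ j = (if j = i then of_real c else 0)" by simp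
          then show ?thesis using False by (simp add: t_def axis_def)
        qed
      qed
      have ti: "herm t (axis i 1) = 0" "herm (axis i 1) t = 0"
        using cnj_herm[of t "axis i 1"] i by (simp_all add: herm_axis t_def)
      have "herm (t + of_real c *s axis i 1) (t + of_real c *s axis i 1) =
          herm t t + of_real (c\<^sup>2)" for c :: real
        unfolding herm_simps ti by (simp add: herm_axis power2_eq_square)
      moreover have "?x = t + of_real a *s axis i 1" by (rule decomp) (use a in auto)
      moreover have "?y = t + of_real b *s axis i 1" by (rule decomp) (use b low in auto)
      moreover have "herm ?x ?x = herm ?y ?y" using gram Suc.prems by blast
      ultimately have "complex_of_real (a\<^sup>2) = of_real (b\<^sup>2)" by (metis add_left_cancel)
      then have "a\<^sup>2 = b\<^sup>2" by (simp only: of_real_eq_iff)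
      then show ?thesis using a(1) b(1) by (simp add: power2_eq_iff_nonneg)
    qed
    have "?x = ?y"
      using low a(3) b(3) ab unfolding Finite_Cartesian_Product.vec_eq_iff by (metis not_le)
    then have "\<forall>j\<le>Suc k. xs ! j = ys ! j" using eq le_Suc_eq by auto
    moreover have "N (Suc k) = M (Suc k)" using a(2) b(2) ab by simp
    moreover have "v = 0" if v: "supported_upto (N (Suc k)) v"
      and orth: "\<forall>j\<le>Suc k. herm v (xs ! j) = 0" for v
    proof (cases "a > 0")
      case False
      then show ?thesis using full[of v] v orth a(2) by auto
    next
      case True
      then obtain i :: 'n where i: "coord_pos i = Suc ?m" using a(4) by blast
      \<comment> \<open>Orthogonality to the earlier points confines \<open>v\<close> to the new
        axis, on which the new point has the nonzero entry \<open>a\<close>.\<close>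
      have "truncate_at ?m v = 0"
        by (rule full[OF supported_truncate_at]) (use herm_truncate_at[OF sup] orth in auto)
      then have tv: "v $ j = 0" if "coord_pos j \<le> ?m" for j
        using that by (auto simp: Finite_Cartesian_Product.vec_eq_iff split: if_splits)
      have vi: "v = axis i (v $ i)"
      proof (subst Finite_Cartesian_Product.vec_eq_iff, rule allI)
        fix j
        show "v $ j = axis i (v $ i) $ j"
          using tv[of j] v True a(2) i coord_pos_inj[of j i] unfolding supported_upto_def
          by (cases "coord_pos j" "Suc ?m" rule: linorder_cases) (auto simp: axis_def)
      qed
      have "herm ?x v = 0" using orth cnj_herm[of v ?x] by simp
      then have "v $ i = 0"
        using vi herm_axis[of ?x i "v $ i"] a(3)[of i] i True by simp
      then show ?thesis using vi by simp
    qed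
    ultimately show ?case by blast
  qed
  then show ?thesis using len by (intro nth_equalityI) auto
qed

text \<open>
  A complex Householder reflection; it maps \<open>v\<close> to \<open>w\<close> and fixes the orthogonal complement of
  \<open>v - w\<close>. For \<open>v = w\<close> the coefficient is \<open>0\<close> since \<open>x / 0 = 0\<close>.
\<close>

definition reflect :: "complex ^ 'n \<Rightarrow> complex ^ 'n \<Rightarrow> complex ^ 'n \<Rightarrow> complex ^ 'n" where
  "reflect v w z = z - (herm z (v - w) / herm v (v - w)) *s (v - w)"

text \<open>This identity makes the reflection unitary, and it shows that the denominator
  \<open>herm v (v - w)\<close> vanishes only for \<open>v = w\<close>.\<close>

lemma herm_diff_eq_norm:
  assumes "norm v = norm w"
  shows "herm v (v - w) + cnj (herm v (v - w)) = herm (v - w) (v - w)"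
proof -
  have "herm v v = herm w w" using assms by (simp add: herm_self)
  then show ?thesis by (simp add: herm_simps cnj_herm)
qed

text \<open>With \<open>u = v - w\<close>, subtracting \<open>(herm z u / b) *s u\<close> is unitary
  because \<open>herm u u = b + cnj b\<close>. The coefficient is complex because the real
  reflection factor \<open>2 / (norm u)\<^sup>2\<close> would send \<open>v\<close> to
  \<open>w\<close> only when \<open>herm v w\<close> is real.\<close>

lemma unitary_reflect:
  assumes "norm v = norm w" shows "unitary_map (reflect v w)"
  unfolding unitary_map_def
proof (intro conjI allI)
  fix x y :: "complex ^ 'a" and c :: complex
  define u b where "u = v - w" and "b = herm v u"
  have R: "reflect v w z = z - (herm z u / b) *s u" for z
    by (simp add: reflect_def u_def b_def)
  show "reflect v w (x + y) = reflect v w x + reflect v w y"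
    unfolding R by (simp add: herm_simps add_divide_distrib vector_sadd_rdistrib)
  show "reflect v w (c *s x) = c *s reflect v w x"
    unfolding R by (simp add: herm_simps vector_ssub_ldistrib)
  have bb: "herm u u = b + cnj b"
    using herm_diff_eq_norm[OF assms] by (simp add: u_def b_def)
  have uy: "cnj (herm y u) = herm u y" by (rule cnj_herm)
  show "herm (reflect v w x) (reflect v w y) = herm x y"
  proof (cases "b = 0")
    case True
    then show ?thesis unfolding R by simp
  next
    case False
    have "herm (reflect v w x) (reflect v w y) =
      herm x y - (herm u y / cnj b) * herm x u - (herm x u / b) * (herm u y - (herm u y / cnj b) * (b + cnj b))"
      unfolding R herm_simps bb complex_cnj_divide uy by (simp only: algebra_simps)
    also have "\<dots> = herm x y" using False by (simp add: field_simps)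
    finally show ?thesis .
  qed
qed

lemma reflect_maps:
  assumes "norm v = norm w" shows "reflect v w v = w"
proof (cases "herm v (v - w) = 0")
  case True
  then have "herm (v - w) (v - w) = 0" using herm_diff_eq_norm[OF assms] by simp
  then have "v = w" unfolding herm_self by simp
  then show ?thesis by (simp add: reflect_def)
qed (simp add: reflect_def)

lemma reflect_fixes: "herm z (v - w) = 0 \<Longrightarrow> reflect v w z = z"
  by (simp add: reflect_def)

section \<open>Reaching a normal form by unitary maps\<close>

lemma unitary_map_0: "unitary_map U \<Longrightarrow> U 0 = 0"
  using unitary_map_norm[of U 0] by simp

lemma rank_profile_snoc:
  assumes N: "rank_profile N xs" and ne: "xs \<noteq> []"
    and p: "p = N (length xs - 1) \<or> p = Suc (N (length xs - 1)) \<and>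
      (\<exists>i. coord_pos i = p \<and> (\<exists>a::real. a > 0 \<and> x $ i = of_real a))"
    and sup: "supported_upto p x"
  shows "rank_profile (N(length xs := p)) (xs @ [x])"
proof -
  \<comment> \<open>For nonempty \<open>xs\<close> the only new step starts at the last old index,
    \<open>length xs - 1\<close>.\<close>
  have len: "Suc k < Suc (length xs) \<longleftrightarrow> Suc k < length xs \<or> k = length xs - 1" for k
    using ne by (cases xs) auto
  have last: "Suc (length xs - 1) = length xs" using ne by simp
  show ?thesis
    unfolding rank_profile_def length_append_singleton len
  proof (intro conjI allI impI)
    show "(N(length xs := p)) 0 = 0" using N ne by (simp add: rank_profile_def)
    fix k
    { assume "Suc k < length xs \<or> k = length xs - 1"
      then show "(N(length xs := p)) (Suc k) = (N(length xs := p)) k \<or>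
          (N(length xs := p)) (Suc k) = (N(length xs := p)) k + 1"
        using N p last by (elim disjE) (auto simp: rank_profile_def) }
    { assume "k < Suc (length xs)"
      then show "supported_upto ((N(length xs := p)) k) ((xs @ [x]) ! k)"
        using N sup unfolding rank_profile_def by (cases "k = length xs") (auto simp: nth_append) }
    { assume k: "(Suc k < length xs \<or> k = length xs - 1) \<and>
          (N(length xs := p)) k < (N(length xs := p)) (Suc k)"
      show "\<exists>i. coord_pos i = (N(length xs := p)) (Suc k) \<and>
          (\<exists>a>0. (xs @ [x]) ! Suc k $ i = of_real a)"
      proof (cases "Suc k < length xs")
        case True
        then show ?thesis using N k unfolding rank_profile_def by (simp add: nth_append)
      next
        case False
        then have k': "k = length xs - 1" "Suc k = length xs" "k \<noteq> length xs" using k last by auto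
        then show ?thesis using k p by (auto simp: nth_append)
      qed }
  qed
qed

text \<open>The list is extended at its end. The part of the new point beyond the current rank is
  reflected onto the next axis; the earlier points have no entries there, hence are orthogonal to
  the reflection vector and stay fixed.\<close>

lemma unitary_normal_form_exists:
  fixes xs :: "(complex ^ 'n::{finite,linorder}) list"
  assumes "set xs \<subseteq> unit_ball" "xs \<noteq> [] \<longrightarrow> xs ! 0 = 0"
  shows "\<exists>U. unitary_map U \<and> in_normal_form (map U xs)"
  using assms
proof (induction xs rule: rev_induct)
  case Nil
  have "unitary_map (\<lambda>z :: complex ^ 'n::{finite,linorder}. z)" by (simp add: unitary_map_def)
  then show ?case by (intro exI[of _ "\<lambda>z. z"]) (auto simp: in_normal_form_iff rank_profile_def)
next
  case (snoc x xs)
  show ?case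
  proof (cases "xs = []")
    case True
    have "unitary_map (\<lambda>z :: complex ^ 'n::{finite,linorder}. z)" by (simp add: unitary_map_def)
    moreover have "in_normal_form [0 :: complex ^ 'n::{finite,linorder}]"
      unfolding in_normal_form_iff rank_profile_def
      by (auto simp: supported_upto_def intro!: exI[of _ "\<lambda>_. 0"])
    ultimately show ?thesis using True snoc.prems by (intro exI[of _ "\<lambda>z. z"]) simp
  next
    case False
    then obtain U N where U: "unitary_map U" and N: "rank_profile N (map U xs)"
      using snoc by (auto simp: nth_append in_normal_form_iff)
    let ?m = "N (length xs - 1)"
    define x' where "x' = U x"
    define v where "v = x' - truncate_at ?m x'"
    have sup: "supported_upto ?m (U z)" if z: "z \<in> set xs" for z
    proof -
      obtain j where j: "j < length xs" "z = xs ! j" using z by (metis in_set_conv_nth)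
      then show ?thesis
        using rank_profile_supported[OF N, of j "length xs - 1"] by simp
    qed
    have V: "\<exists>V p. unitary_map V \<and> (\<forall>z\<in>set xs. V (U z) = U z) \<and> supported_upto p (V x') \<and>
       (p = ?m \<or> p = Suc ?m \<and> (\<exists>i. coord_pos i = p \<and> (\<exists>a::real. a > 0 \<and> V x' $ i = of_real a)))"
    proof (cases "v = 0")
      case True
      then have "supported_upto ?m x'" using supported_truncate_at[of ?m x'] by (simp add: v_def)
      then show ?thesis
        by (intro exI[of _ "\<lambda>z. z"] exI[of _ ?m]) (simp add: unitary_map_def)
    next
      case False
      then obtain i0 where "v $ i0 \<noteq> 0" by (auto simp: Finite_Cartesian_Product.vec_eq_iff)
      then have "?m < coord_pos i0" by (auto simp: v_def split: if_splits)
      then obtain i :: 'n where i: "coord_pos i = Suc ?m" by (rule coord_pos_exists)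
      \<comment> \<open>The entry \<open>norm v\<close> is forced: it gives \<open>w\<close> the
        norm of \<open>v\<close>, as the reflection requires, and makes the pivot positive.\<close>
      define w where "w = axis i (complex_of_real (norm v))"
      have "herm w w = of_real ((norm v)\<^sup>2)" by (simp add: w_def herm_axis power2_eq_square)
      then have "(norm v)\<^sup>2 = (norm w)\<^sup>2" by (simp add: herm_self del: of_real_power)
      then have nvw: "norm v = norm w" by simp
      have "truncate_at ?m (v - w) = 0"
        using i by (auto simp: Finite_Cartesian_Product.vec_eq_iff v_def w_def axis_def)
      then have orth: "herm z (v - w) = 0" if "supported_upto ?m z" for z
        using herm_disjoint that by blast
      have lin: "reflect v w (a + b) = reflect v w a + reflect v w b" for a b
        using unitary_reflect[OF nvw] by (simp add: unitary_map_def)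
      have "reflect v w x' = reflect v w (truncate_at ?m x' + v)" by (simp add: v_def)
      also have "\<dots> = truncate_at ?m x' + w"
        unfolding lin reflect_maps[OF nvw] by (simp add: reflect_fixes orth supported_truncate_at)
      finally have Vx: "reflect v w x' = truncate_at ?m x' + w" .
      have "supported_upto (Suc ?m) (reflect v w x')"
        unfolding Vx supported_upto_def using i by (auto simp: w_def axis_def)
      moreover have "reflect v w x' $ i = of_real (norm v)" "norm v > 0"
        unfolding Vx using i False by (auto simp: w_def)
      moreover have "\<forall>z\<in>set xs. reflect v w (U z) = U z"
        using sup orth by (simp add: reflect_fixes)
      ultimately show ?thesis
        using unitary_reflect[OF nvw] i
        by (intro exI[of _ "reflect v w"] exI[of _ "Suc ?m"]) blast
    qed
    then obtain V p where V: "unitary_map V" "\<And>z. z \<in> set xs \<Longrightarrow> V (U z) = U z"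
      and p: "supported_upto p (V x')"
       "p = ?m \<or> p = Suc ?m \<and> (\<exists>i. coord_pos i = p \<and> (\<exists>a::real. a > 0 \<and> V x' $ i = of_real a))"
      by blast
    have VU: "unitary_map (V \<circ> U)" by (rule unitary_map_comp[OF U V(1)])
    have "map (V \<circ> U) (xs @ [x]) = map U xs @ [V x']" using V(2) by (simp add: x'_def)
    moreover have "rank_profile (N(length (map U xs) := p)) (map U xs @ [V x'])"
      by (rule rank_profile_snoc[OF N]) (use False p in auto)
    moreover have "set (map (V \<circ> U) (xs @ [x])) \<subseteq> unit_ball"
      using snoc.prems(1) unitary_map_norm[OF VU] by auto
    moreover have "map (V \<circ> U) (xs @ [x]) ! 0 = 0"
      using snoc.prems(2) unitary_map_0[OF VU] by (subst nth_map) simp_all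
    ultimately have "in_normal_form (map (V \<circ> U) (xs @ [x]))"
      unfolding in_normal_form_iff by metis
    with VU show ?thesis by blast
  qed
qed

section \<open>Congruence and the Gram matrix after moving the first point to the origin\<close>

definition centered_gram :: "(complex ^ 'n) list \<Rightarrow> nat \<Rightarrow> nat \<Rightarrow> complex" where
  "centered_gram xs i j =
    herm (ball_involution (xs ! 0) (xs ! i)) (ball_involution (xs ! 0) (xs ! j))"

lemma ball_involution_0: "a \<in> unit_ball \<Longrightarrow> ball_involution a 0 = a"
  using ball_involution_ball_involution[of a a] ball_involution_self[of a] by simp

text \<open>Conjugating \<open>f\<close> by the involutions at \<open>a\<close> and
  \<open>f a\<close> gives an automorphism fixing \<open>0\<close>, which preserves
  products.\<close>

lemma herm_ball_involution_ball_aut: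
  assumes f: "f \<in> ball_aut" and a: "a \<in> unit_ball" and z: "z \<in> unit_ball" and w: "w \<in> unit_ball"
  shows "herm (ball_involution (f a) (f z)) (ball_involution (f a) (f w)) =
    herm (ball_involution a z) (ball_involution a w)"
proof -
  define g where "g = ball_involution (f a) \<circ> (f \<circ> ball_involution a)"
  have fa: "f a \<in> unit_ball" by (rule ball_aut_in_ball[OF f a])
  have g: "g \<in> ball_aut"
    unfolding g_def by (intro ball_aut_comp ball_involution_ball_aut a f fa)
  have "g 0 = 0"
    using ball_involution_self[OF fa] by (simp add: g_def ball_involution_0[OF a])
  from ball_aut_fix_0_herm[OF g this ball_involution_in_ball[OF a z] ball_involution_in_ball[OF a w]]
  show ?thesis
    by (simp add: g_def ball_involution_ball_involution a z w del: mem_ball mem_ball_0)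
qed

text \<open>For each entry the triangle with indices \<open>0\<close>, \<open>i\<close>,
  \<open>j\<close> is used; its automorphism may vary with the entry.\<close>

lemma congruent_triangles_centered_gram:
  assumes "congruent_triangles xs ys" "set xs \<subseteq> unit_ball" "i < length xs" "j < length xs"
  shows "centered_gram ys i j = centered_gram xs i j"
proof -
  have 0: "0 < length xs" using assms(3) by auto
  obtain f where f: "f \<in> ball_aut" "f (xs ! 0) = ys ! 0" "f (xs ! i) = ys ! i" "f (xs ! j) = ys ! j"
    using assms(1,3,4) 0 unfolding congruent_triangles_def by blast
  have "xs ! k \<in> unit_ball" if "k < length xs" for k
    using assms(2) that nth_mem by blast
  then show ?thesis
    using herm_ball_involution_ball_aut[OF f(1), of "xs ! 0" "xs ! i" "xs ! j"] f(2,3,4) 0 assms(3,4)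
    unfolding centered_gram_def by metis
qed

section \<open>Congruence classes and their normal forms\<close>

lemma congruent_sets_trans:
  assumes "congruent_sets xs ys" "congruent_sets ys zs"
  shows "congruent_sets xs zs"
proof -
  obtain f g where "f \<in> ball_aut" "g \<in> ball_aut" "map f xs = ys" "map g ys = zs"
    using assms unfolding congruent_sets_def by blast
  then show ?thesis
    unfolding congruent_sets_def by (intro bexI[of _ "g \<circ> f"] ball_aut_comp) auto
qed

lemma congruent_sets_sym:
  assumes "congruent_sets xs ys" "set xs \<subseteq> unit_ball"
  shows "congruent_sets ys xs"
proof -
  obtain f where f: "f \<in> ball_aut" "map f xs = ys"
    using assms unfolding congruent_sets_def by blast
  obtain g where g: "g \<in> ball_aut" "\<And>z. z \<in> unit_ball \<Longrightarrow> g (f z) = z"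
    using ball_autE[OF f(1)] by metis
  have "map g ys = xs"
    unfolding f(2)[symmetric] map_map by (rule map_idI) (use g(2) assms(2) in auto)
  with g(1) show ?thesis unfolding congruent_sets_def by blast
qed

lemma in_normal_form_exists:
  fixes xs :: "(complex ^ 'n::{finite,linorder}) list"
  assumes xs: "set xs \<subseteq> unit_ball"
  obtains zs where "congruent_sets xs zs" "in_normal_form zs" "length zs = length xs"
    "\<And>i j. i < length xs \<Longrightarrow> j < length xs \<Longrightarrow> herm (zs ! i) (zs ! j) = centered_gram xs i j"
proof (cases "xs = []")
  case True
  \<comment> \<open>Even for the empty list \<open>congruent_sets\<close> asks for some
    automorphism.\<close>
  have "ball_involution (0 :: complex ^ 'n::{finite,linorder}) \<in> ball_aut"
    by (rule ball_involution_ball_aut) simp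
  then have "congruent_sets xs []" using True unfolding congruent_sets_def by auto
  moreover have "in_normal_form ([] :: (complex ^ 'n::{finite,linorder}) list)"
    by (auto simp: in_normal_form_def)
  ultimately show ?thesis using that True by auto
next
  case False
  then have a: "xs ! 0 \<in> unit_ball" using xs nth_mem by blast
  let ?\<phi> = "ball_involution (xs ! 0)"
  have "set (map ?\<phi> xs) \<subseteq> unit_ball" using ball_involution_in_ball[OF a] xs by auto
  moreover have "map ?\<phi> xs ! 0 = 0" using False ball_involution_self[OF a] by simp
  ultimately obtain U where U: "unitary_map U" "in_normal_form (map U (map ?\<phi> xs))"
    using unitary_normal_form_exists by blast
  show ?thesis
  proof (rule that[OF _ U(2)])
    show "congruent_sets xs (map U (map ?\<phi> xs))"
      unfolding congruent_sets_def
      by (intro bexI[of _ "U \<circ> ?\<phi>"] ball_aut_comp ball_involution_ball_aut a unitary_map_ball_aut U) simp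
    show "herm (map U (map ?\<phi> xs) ! i) (map U (map ?\<phi> xs) ! j) = centered_gram xs i j"
      if "i < length xs" "j < length xs" for i j
      using U(1) that by (simp add: unitary_map_def centered_gram_def)
  qed simp
qed

text \<open>Each list is congruent to a normal form whose products are its centered Gram matrix, so
  uniqueness makes the two normal forms equal.\<close>

lemma centered_gram_congruent:
  fixes xs ys :: "(complex ^ 'n::{finite,linorder}) list"
  assumes xs: "set xs \<subseteq> unit_ball" and ys: "set ys \<subseteq> unit_ball" and len: "length ys = length xs"
    and gram: "\<And>i j. i < length xs \<Longrightarrow> j < length xs \<Longrightarrow> centered_gram ys i j = centered_gram xs i j"
  shows "congruent_sets xs ys"
proof -
  obtain zs where zs: "congruent_sets xs zs" "in_normal_form zs" "length zs = length xs"
    "\<And>i j. i < length xs \<Longrightarrow> j < length xs \<Longrightarrow> herm (zs ! i) (zs ! j) = centered_gram xs i j"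
    using in_normal_form_exists[OF xs] by metis
  obtain ws where ws: "congruent_sets ys ws" "in_normal_form ws" "length ws = length ys"
    "\<And>i j. i < length ys \<Longrightarrow> j < length ys \<Longrightarrow> herm (ws ! i) (ws ! j) = centered_gram ys i j"
    using in_normal_form_exists[OF ys] by metis
  have "zs = ws"
    by (rule normal_form_unique[OF zs(2) ws(2)]) (use zs(3,4) ws(3,4) len gram in auto)
  then show ?thesis
    using congruent_sets_trans[OF zs(1)] congruent_sets_sym[OF ws(1) ys] by simp
qed

text \<open>Both lists start at \<open>0\<close>, so the automorphism between them fixes
  \<open>0\<close> and preserves products.\<close>

lemma congruent_normal_forms_eq:
  assumes "congruent_sets zs ws" "in_normal_form zs" "in_normal_form ws"
  shows "zs = ws"
proof -
  obtain f where f: "f \<in> ball_aut" "map f zs = ws"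
    using assms(1) unfolding congruent_sets_def by blast
  have len: "length ws = length zs" using f(2) by auto
  show ?thesis
  proof (rule normal_form_unique[OF assms(2,3) len])
    fix i j assume ij: "i < length zs" "j < length zs"
    then have ne: "zs \<noteq> []" "ws \<noteq> []" using len by auto
    then have "f (zs ! 0) = ws ! 0" unfolding f(2)[symmetric] by (simp add: nth_map)
    then have "f 0 = 0" using assms(2,3) ne unfolding in_normal_form_iff by metis
    moreover have "zs ! i \<in> unit_ball" "zs ! j \<in> unit_ball"
      using assms(2) ij unfolding in_normal_form_def by blast+
    ultimately have "herm (f (zs ! i)) (f (zs ! j)) = herm (zs ! i) (zs ! j)"
      by (intro ball_aut_fix_0_herm f)
    then show "herm (zs ! i) (zs ! j) = herm (ws ! i) (ws ! j)"
      unfolding f(2)[symmetric] using ij by (simp add: nth_map)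
  qed
qed

text \<open>Resolves the definite description: any two normal forms of \<open>xs\<close> are
  congruent to each other through \<open>xs\<close>.\<close>

lemma normal_form_eqI:
  assumes zs: "congruent_sets xs zs" "in_normal_form zs" and xs: "set xs \<subseteq> unit_ball"
  shows "normal_form xs = zs"
  unfolding normal_form_def
proof (rule the_equality)
  show "in_normal_form zs \<and> (\<exists>\<Psi>\<in>ball_aut. zs = map \<Psi> xs)"
    using zs unfolding congruent_sets_def by blast
  fix ys assume "in_normal_form ys \<and> (\<exists>\<Psi>\<in>ball_aut. ys = map \<Psi> xs)"
  then have "congruent_sets xs ys" "in_normal_form ys" unfolding congruent_sets_def by blast+
  then show "ys = zs"
    using congruent_normal_forms_eq congruent_sets_trans congruent_sets_sym[OF _ xs] zs by metis
qed

lemma congruent_iff_normal_form: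
  fixes xs ys :: "(complex ^ 'n::{finite,linorder}) list"
  assumes xs: "set xs \<subseteq> unit_ball" and ys: "set ys \<subseteq> unit_ball"
  shows "congruent_sets xs ys \<longleftrightarrow> normal_form xs = normal_form ys"
proof -
  obtain zs where zs: "congruent_sets xs zs" "in_normal_form zs"
    using in_normal_form_exists[OF xs] by metis
  obtain ws where ws: "congruent_sets ys ws" "in_normal_form ws"
    using in_normal_form_exists[OF ys] by metis
  have eq: "normal_form xs = zs" "normal_form ys = ws"
    using normal_form_eqI zs ws xs ys by blast+
  show ?thesis
  proof
    assume "congruent_sets xs ys"
    then show "normal_form xs = normal_form ys"
      using normal_form_eqI[OF congruent_sets_trans[OF _ ws(1)] ws(2) xs] eq by simp
  next
    assume "normal_form xs = normal_form ys"
    then show "congruent_sets xs ys"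
      using congruent_sets_trans[OF zs(1)] congruent_sets_sym[OF ws(1) ys] eq by simp
  qed
qed

section \<open>Rescaling\<close>

text \<open>A common form of the two scaling conditions: scalars attached to indices stand both for
  a function on the points and for the entries of a diagonal matrix.\<close>

definition rescaled_by :: "(nat \<Rightarrow> complex) \<Rightarrow> (complex ^ 'n) list \<Rightarrow> (complex ^ 'n) list \<Rightarrow> bool" where
  "rescaled_by g xs ys \<longleftrightarrow> (\<forall>i<length xs. g i \<noteq> 0) \<and>
    (\<forall>i<length xs. \<forall>j<length xs.
       da_inner (da_kernel (ys ! i)) (da_kernel (ys ! j)) =
       g i * cnj (g j) * da_inner (da_kernel (xs ! i)) (da_kernel (xs ! j)))"

text \<open>Distinctness of \<open>xs\<close> makes scalars attached to indices well defined as a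
  function on points.\<close>

lemma da_rescaling_iff:
  assumes "distinct xs"
  shows "da_rescaling xs ys \<longleftrightarrow> (\<exists>g. rescaled_by g xs ys)"
proof
  assume "da_rescaling xs ys"
  then obtain \<gamma> where \<gamma>: "\<forall>x\<in>set xs. \<gamma> x \<noteq> 0" "\<forall>i<length xs. \<forall>j<length xs.
      da_inner (da_kernel (ys ! i)) (da_kernel (ys ! j)) =
      \<gamma> (xs ! i) * cnj (\<gamma> (xs ! j)) * da_inner (da_kernel (xs ! i)) (da_kernel (xs ! j))"
    unfolding da_rescaling_def by blast
  then have "rescaled_by (\<lambda>i. \<gamma> (xs ! i)) xs ys" unfolding rescaled_by_def by simp
  then show "\<exists>g. rescaled_by g xs ys" by blast
next
  assume "\<exists>g. rescaled_by g xs ys"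
  then obtain g where g: "rescaled_by g xs ys" by blast
  define \<gamma> where "\<gamma> x = g (the_inv_into {..<length xs} (nth xs) x)" for x
  have \<gamma>: "\<gamma> (xs ! i) = g i" if "i < length xs" for i
    unfolding \<gamma>_def using the_inv_into_f_f[OF inj_on_nth[OF assms], of "{..<length xs}" i] that by simp
  then have "\<forall>x\<in>set xs. \<gamma> x \<noteq> 0"
    using g unfolding rescaled_by_def by (auto simp: in_set_conv_nth)
  then show "da_rescaling xs ys"
    unfolding da_rescaling_def using g \<gamma> unfolding rescaled_by_def by (intro exI[of _ \<gamma>]) simp
qed

lemma diagonal_mat_sandwich:
  fixes A :: "complex mat"
  assumes "\<Gamma> \<in> carrier_mat n n" "diagonal_mat \<Gamma>" "A \<in> carrier_mat n n" "i < n" "j < n"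
  shows "(\<Gamma> * A * map_mat cnj \<Gamma>) $$ (i, j) = \<Gamma> $$ (i, i) * cnj (\<Gamma> $$ (j, j)) * A $$ (i, j)"
proof -
  have dim: "dim_row \<Gamma> = n" "dim_col \<Gamma> = n" "dim_row A = n" "dim_col A = n" using assms by auto
  have off: "\<Gamma> $$ (k, l) = 0" if "k < n" "l < n" "k \<noteq> l" for k l
    using assms(2) that dim unfolding diagonal_mat_def by auto
  define B where "B = \<Gamma> * A"
  have B: "dim_row B = n" "dim_col B = n" using dim by (simp_all add: B_def)
  have left: "B $$ (i, k) = \<Gamma> $$ (i, i) * A $$ (i, k)" if "k < n" for k
  proof -
    have "B $$ (i, k) = (\<Sum>l\<in>{0..<n}. \<Gamma> $$ (i, l) * A $$ (l, k))"
      unfolding B_def using that assms dim by (simp add: scalar_prod_def)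
    also have "\<dots> = (\<Sum>l\<in>{0..<n}. if l = i then \<Gamma> $$ (i, i) * A $$ (i, k) else 0)"
      by (rule sum.cong) (use off assms(4) in auto)
    finally show ?thesis using assms(4) by simp
  qed
  have "(B * map_mat cnj \<Gamma>) $$ (i, j) = (\<Sum>k\<in>{0..<n}. B $$ (i, k) * cnj (\<Gamma> $$ (k, j)))"
    using assms dim B by (simp add: scalar_prod_def)
  also have "\<dots> = (\<Sum>k\<in>{0..<n}. if k = j then \<Gamma> $$ (i, i) * A $$ (i, j) * cnj (\<Gamma> $$ (j, j)) else 0)"
    by (rule sum.cong) (use off left assms(5) in auto)
  finally show ?thesis using assms(5) by (simp add: B_def)
qed

lemma mat_equiv_da_gram_iff:
  assumes len: "length ys = length xs"
  shows "mat_equiv (da_gram xs) (da_gram ys) \<longleftrightarrow> (\<exists>g. rescaled_by g xs ys)"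
proof
  let ?n = "length xs"
  have carrier: "da_gram xs \<in> carrier_mat ?n ?n" by (simp add: da_gram_def)
  {
    assume "mat_equiv (da_gram xs) (da_gram ys)"
    then obtain \<Gamma> where \<Gamma>: "\<Gamma> \<in> carrier_mat ?n ?n" "diagonal_mat \<Gamma>" "\<forall>i<?n. \<Gamma> $$ (i, i) \<noteq> 0"
      "\<Gamma> * da_gram xs * map_mat cnj \<Gamma> = da_gram ys"
      using carrier unfolding mat_equiv_def by auto
    have "rescaled_by (\<lambda>i. \<Gamma> $$ (i, i)) xs ys"
      unfolding rescaled_by_def
    proof (intro conjI allI impI)
      fix i j assume ij: "i < ?n" "j < ?n"
      from diagonal_mat_sandwich[OF \<Gamma>(1,2) carrier ij]
      show "da_inner (da_kernel (ys ! i)) (da_kernel (ys ! j)) =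
          \<Gamma> $$ (i, i) * cnj (\<Gamma> $$ (j, j)) * da_inner (da_kernel (xs ! i)) (da_kernel (xs ! j))"
        unfolding \<Gamma>(4) using ij len by (simp add: da_gram_def)
    qed (use \<Gamma>(3) in blast)
    then show "\<exists>g. rescaled_by g xs ys" by blast
  next
    assume "\<exists>g. rescaled_by g xs ys"
    then obtain g where g: "rescaled_by g xs ys" by blast
    define \<Gamma> where "\<Gamma> = mat ?n ?n (\<lambda>(i, j). if i = j then g i else 0)"
    have \<Gamma>: "\<Gamma> \<in> carrier_mat ?n ?n" "diagonal_mat \<Gamma>"
      by (auto simp: \<Gamma>_def diagonal_mat_def)
    have "\<Gamma> * da_gram xs * map_mat cnj \<Gamma> = da_gram ys"
    proof (rule eq_matI)
      fix i j assume "i < dim_row (da_gram ys)" "j < dim_col (da_gram ys)"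
      then have ij: "i < ?n" "j < ?n" using len by (simp_all add: da_gram_def)
      show "(\<Gamma> * da_gram xs * map_mat cnj \<Gamma>) $$ (i, j) = da_gram ys $$ (i, j)"
        unfolding diagonal_mat_sandwich[OF \<Gamma> carrier ij]
        using ij len g by (simp add: \<Gamma>_def da_gram_def rescaled_by_def)
    qed (use \<Gamma> carrier len in \<open>auto simp: da_gram_def\<close>)
    moreover have "\<forall>i<?n. \<Gamma> $$ (i, i) \<noteq> 0" using g by (simp add: \<Gamma>_def rescaled_by_def)
    ultimately show "mat_equiv (da_gram xs) (da_gram ys)"
      unfolding mat_equiv_def using \<Gamma> carrier by auto
  }
qed

lemma da_inner_kernel_eq:
  assumes "x \<in> unit_ball" "y \<in> unit_ball"
  shows "da_inner (da_kernel x) (da_kernel y) = 1 / (1 - herm y x)"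
  using da_inner_kernel[OF assms] assms(2) by (simp add: da_kernel_def)

text \<open>In the cross ratio \<open>p 0 0 * p i j / (p i 0 * p 0 j)\<close> every index occurs
  once on each side in both the numerator and the denominator, so the scalars cancel. Conversely,
  equality of cross ratios is solved for the scalars from the row of the first point.\<close>

lemma rescaled_by_iff_centered_gram:
  fixes xs ys :: "(complex ^ 'n) list"
  assumes xs: "set xs \<subseteq> unit_ball" and ys: "set ys \<subseteq> unit_ball" and len: "length ys = length xs"
  shows "(\<exists>g. rescaled_by g xs ys) \<longleftrightarrow>
    (\<forall>i<length xs. \<forall>j<length xs. centered_gram ys i j = centered_gram xs i j)"
proof -
  let ?n = "length xs"
  define p q where "p i j = 1 - herm (xs ! i) (xs ! j)" and "q i j = 1 - herm (ys ! i) (ys ! j)" for i j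
  have xb: "xs ! i \<in> unit_ball" and yb: "ys ! i \<in> unit_ball" if "i < ?n" for i
    using xs ys len that nth_mem by (blast, metis subsetD nth_mem)
  have p0: "p i j \<noteq> 0" and q0: "q i j \<noteq> 0" if "i < ?n" "j < ?n" for i j
    unfolding p_def q_def using herm_neq_1 xb yb that by blast+
  have cp: "cnj (p i j) = p j i" and cq: "cnj (q i j) = q j i" for i j
    by (simp_all add: p_def q_def cnj_herm)
  have gram: "centered_gram ys i j = centered_gram xs i j \<longleftrightarrow>
      q 0 0 * q i j / (q i 0 * q 0 j) = p 0 0 * p i j / (p i 0 * p 0 j)"
    if ij: "i < ?n" "j < ?n" for i j
  proof -
    have 0: "0 < ?n" using ij by auto
    have "1 - centered_gram ys i j = q 0 0 * q i j / (q i 0 * q 0 j)"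
      unfolding centered_gram_def q_def by (rule ball_involution_herm) (use yb ij 0 in auto)
    moreover have "1 - centered_gram xs i j = p 0 0 * p i j / (p i 0 * p 0 j)"
      unfolding centered_gram_def p_def by (rule ball_involution_herm) (use xb ij 0 in auto)
    ultimately show ?thesis by (metis diff_left_imp_eq)
  qed
  \<comment> \<open>The kernel entries are reciprocals with the indices swapped, so the scalars now
    multiply the numbers \<open>q\<close> of \<open>ys\<close>.\<close>
  have resc: "rescaled_by g xs ys \<longleftrightarrow> (\<forall>i<?n. g i \<noteq> 0) \<and>
      (\<forall>i<?n. \<forall>j<?n. p j i = g i * cnj (g j) * q j i)" for g
  proof -
    have "1 / q j i = g i * cnj (g j) * (1 / p j i) \<longleftrightarrow> p j i = g i * cnj (g j) * q j i"
      if "i < ?n" "j < ?n" for i j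
      using p0[OF that(2,1)] q0[OF that(2,1)] by (auto simp: field_simps)
    then show ?thesis
      unfolding rescaled_by_def using xb yb
      by (simp add: da_inner_kernel_eq p_def q_def del: mem_ball mem_ball_0)
  qed
  show ?thesis
  proof
    assume "\<exists>g. rescaled_by g xs ys"
    then obtain g where g: "\<And>i. i < ?n \<Longrightarrow> g i \<noteq> 0"
      "\<And>i j. i < ?n \<Longrightarrow> j < ?n \<Longrightarrow> p j i = g i * cnj (g j) * q j i"
      unfolding resc by blast
    show "\<forall>i<?n. \<forall>j<?n. centered_gram ys i j = centered_gram xs i j"
    proof (intro allI impI)
      fix i j assume ij: "i < ?n" "j < ?n"
      then have 0: "0 < ?n" by auto
      show "centered_gram ys i j = centered_gram xs i j"
        unfolding gram[OF ij] g(2)[OF 0 0] g(2)[OF ij(2,1)] g(2)[OF 0 ij(1)] g(2)[OF ij(2) 0]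
        using g(1)[OF 0] g(1)[OF ij(1)] g(1)[OF ij(2)] by (simp add: divide_simps)
    qed
  next
    assume eq: "\<forall>i<?n. \<forall>j<?n. centered_gram ys i j = centered_gram xs i j"
    have norm_less: "(norm x)\<^sup>2 < 1" if "x \<in> unit_ball" for x :: "complex ^ 'n"
      using that by (simp add: abs_square_less_1)
    \<comment> \<open>The required relation at \<open>p 0 i\<close> forces \<open>g i\<close> to be
      a constant times \<open>p 0 i / q 0 i\<close>, and the one at \<open>p 0 0\<close> forces the
      squared modulus of that constant to be \<open>q 0 0 / p 0 0\<close>. Its positive root is
      taken.\<close>
    define r where "r = complex_of_real (sqrt ((1 - (norm (ys ! 0))\<^sup>2) / (1 - (norm (xs ! 0))\<^sup>2)))"
    define g where "g i = r * p 0 i / q 0 i" for i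
    have "rescaled_by g xs ys"
      unfolding resc
    proof (intro conjI allI impI)
      fix i assume i: "i < ?n"
      then have 0: "0 < ?n" by auto
      have "r \<noteq> 0" using norm_less[OF xb[OF 0]] norm_less[OF yb[OF 0]] by (simp add: r_def)
      then show "g i \<noteq> 0" using p0[OF 0 i] q0[OF 0 i] by (simp add: g_def)
      fix j assume j: "j < ?n"
      have "(sqrt ((1 - (norm (ys ! 0))\<^sup>2) / (1 - (norm (xs ! 0))\<^sup>2)))\<^sup>2 =
          (1 - (norm (ys ! 0))\<^sup>2) / (1 - (norm (xs ! 0))\<^sup>2)"
        using norm_less[OF xb[OF 0]] norm_less[OF yb[OF 0]] by (intro real_sqrt_pow2) simp
      then have "r\<^sup>2 = of_real ((1 - (norm (ys ! 0))\<^sup>2) / (1 - (norm (xs ! 0))\<^sup>2))"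
        unfolding r_def of_real_power[symmetric] by simp
      then have r2: "r * cnj r = q 0 0 / p 0 0"
        by (simp add: r_def p_def q_def herm_self power2_eq_square)
      have "q 0 0 * q j i / (q j 0 * q 0 i) = p 0 0 * p j i / (p j 0 * p 0 i)"
        using eq gram i j by blast
      moreover have "g i * cnj (g j) * q j i =
          (r * cnj r) * (p 0 i * p j 0 / (q 0 i * q j 0)) * q j i"
        by (simp add: g_def cp cq)
      then have "g i * cnj (g j) * q j i =
          (q 0 0 * q j i / (q j 0 * q 0 i)) * (p 0 i * p j 0 / p 0 0)"
        unfolding r2 by (simp add: mult.commute mult.left_commute)
      ultimately show "p j i = g i * cnj (g j) * q j i"
        using p0[OF 0 0] p0[OF 0 i] p0[OF j 0] by simp
    qed
    then show "\<exists>g. rescaled_by g xs ys" by blast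
  qed
qed

theorem theorem7:
  fixes xs ys :: "(complex ^ 'n::{finite,linorder}) list"
  assumes "length ys = length xs"
    and "set xs \<subseteq> unit_ball" and "set ys \<subseteq> unit_ball"
    and "distinct xs" and "distinct ys"
  shows "(congruent_sets xs ys \<longleftrightarrow> normal_form xs = normal_form ys) \<and>
         (congruent_sets xs ys \<longleftrightarrow> da_rescaling xs ys) \<and>
         (congruent_sets xs ys \<longleftrightarrow> mat_equiv (da_gram xs) (da_gram ys)) \<and>
         (congruent_sets xs ys \<longleftrightarrow> congruent_triangles xs ys)"
proof -
  \<comment> \<open>Congruence, congruence of triangles and \<open>?G\<close> form a cycle of
    implications; both scaling conditions are attached at \<open>?G\<close>.\<close>
  let ?G = "\<forall>i<length xs. \<forall>j<length xs. centered_gram ys i j = centered_gram xs i j"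
  have "congruent_triangles xs ys" if "congruent_sets xs ys"
    using that unfolding congruent_sets_def congruent_triangles_def by fastforce
  moreover have "?G" if "congruent_triangles xs ys"
    using congruent_triangles_centered_gram[OF that assms(2)] by blast
  moreover have "congruent_sets xs ys" if "?G"
    using centered_gram_congruent[OF assms(2,3,1)] that by blast
  moreover have "(\<exists>g. rescaled_by g xs ys) \<longleftrightarrow> ?G"
    by (rule rescaled_by_iff_centered_gram[OF assms(2,3,1)])
  ultimately show ?thesis
    using congruent_iff_normal_form[OF assms(2,3)] da_rescaling_iff[OF assms(4)]
      mat_equiv_da_gram_iff[OF assms(1)] by blast
qed

end
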